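(* Let $(W,S)$ be an irreducible, right-angled Coxeter system with $S$ finite and $|S|\ge 3$. Then there is an $|S|$-dimensional Euclidean subspace of the set of extremal points of $\mathrm{Char}(W)$ whose interior contains the regular trace.
   Context: A right-angled Coxeter system $(W,S)$ is given by $W=\langle S\mid (st)^{m_{st}}=e\rangle$ with $m_{ss}=1$ and $m_{st}=m_{ts}\in\{2,\infty\}$ for $s\ne t$ (no relation when $m_{st}=\infty$). It is irreducible if there is no partition $S=S_1\sqcup S_2$ into non-empty sets with $W=\langle S_1\rangle\oplus\langle S_2\rangle$. $\mathrm{Char}(W)$ is the convex space of characters of the discrete group $W$, i.e. positive definite, conjugation invariant functions $\tau:W\to\mathbb C$ with $\tau(e)=1$ (equivalently traces on the full group $\mathrm C^*$-algebra), with the topology of pointwise convergence. The regular trace is the character $\delta_e$ ($\tau(e)=1$, $\tau(w)=0$ for $w\neq e$). An $n$-dimensional Euclidean subspace means a subset which, in the subspace topology, is homeomorphic to an $n$-dimensional Euclidean ball; its interior is the image of the interior of the ball. *)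

theory Defs
  imports
    "HOL-Analysis.Analysis"
    "HOL-Algebra.Elementary_Groups"
    "HOL-Library.Extended_Nat"
begin

text \<open>A word is a list of signed letters: \<open>(s, True)\<close> stands for the generator \<open>s\<close> and
  \<open>(s, False)\<close> for its formal inverse.\<close>

type_synonym 'a word = "('a \<times> bool) list"

definition words_over :: "'a set \<Rightarrow> 'a word set" where
  "words_over S = lists (S \<times> UNIV)"

definition letter_value :: "('a, 'b) monoid_scheme \<Rightarrow> 'a \<times> bool \<Rightarrow> 'a" where
  "letter_value G l = (if snd l then fst l else inv\<^bsub>G\<^esub> fst l)"

definition word_value :: "('a, 'b) monoid_scheme \<Rightarrow> 'a word \<Rightarrow> 'a" where
  "word_value G w = foldr (\<lambda>l x. letter_value G l \<otimes>\<^bsub>G\<^esub> x) w \<one>\<^bsub>G\<^esub>"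

text \<open>Equality in the abstract group with generators \<open>S\<close> and relators \<open>R\<close>: the equivalence relation
  on words generated by insertion and deletion of trivial pairs and of relators.\<close>

inductive word_equiv :: "'a set \<Rightarrow> 'a word set \<Rightarrow> 'a word \<Rightarrow> 'a word \<Rightarrow> bool"
  for S :: "'a set" and R :: "'a word set" where
  refl: "word_equiv S R w w"
| sym: "word_equiv S R v w \<Longrightarrow> word_equiv S R w v"
| trans: "word_equiv S R u v \<Longrightarrow> word_equiv S R v w \<Longrightarrow> word_equiv S R u w"
| cancel: "s \<in> S \<Longrightarrow> word_equiv S R (u @ [(s, b), (s, \<not> b)] @ v) (u @ v)"
| relator: "r \<in> R \<Longrightarrow> word_equiv S R (u @ r @ v) (u @ v)"

text \<open>\<open>G = \<langle>S | R\<rangle>\<close>: the canonical homomorphism from the abstractly presented group onto the subgroup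
  of \<open>G\<close> generated by \<open>S\<close> is well defined, injective and onto \<open>G\<close>.\<close>

definition presented_by :: "('a, 'b) monoid_scheme \<Rightarrow> 'a set \<Rightarrow> 'a word set \<Rightarrow> bool" where
  "presented_by G S R \<longleftrightarrow>
     group G \<and> S \<subseteq> carrier G \<and> R \<subseteq> words_over S \<and> generate G S = carrier G \<and>
     (\<forall>w \<in> words_over S. word_value G w = \<one>\<^bsub>G\<^esub> \<longleftrightarrow> word_equiv S R w [])"

text \<open>The relators \<open>(st)\<^sup>m\<close> for \<open>m = m s t\<close> finite; for \<open>m s t = \<infinity>\<close> there is no relator.\<close>

definition coxeter_relators :: "'a set \<Rightarrow> ('a \<Rightarrow> 'a \<Rightarrow> enat) \<Rightarrow> 'a word set" where
  "coxeter_relators S m =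
     {concat (replicate k [(s, True), (t, True)]) | s t k. s \<in> S \<and> t \<in> S \<and> m s t = enat k}"

definition right_angled_coxeter_system ::
  "('a, 'b) monoid_scheme \<Rightarrow> 'a set \<Rightarrow> ('a \<Rightarrow> 'a \<Rightarrow> enat) \<Rightarrow> bool" where
  "right_angled_coxeter_system W S m \<longleftrightarrow>
     (\<forall>s\<in>S. m s s = 1) \<and>
     (\<forall>s\<in>S. \<forall>t\<in>S. s \<noteq> t \<longrightarrow> m s t = m t s \<and> m s t \<in> {2, \<infinity>}) \<and>
     presented_by W S (coxeter_relators S m)"

definition internal_direct_sum ::
  "('a, 'b) monoid_scheme \<Rightarrow> 'a set \<Rightarrow> 'a set \<Rightarrow> bool" where
  "internal_direct_sum W S1 S2 \<longleftrightarrow>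
     (\<lambda>(x, y). x \<otimes>\<^bsub>W\<^esub> y) \<in> iso (subgroup_generated W S1 \<times>\<times> subgroup_generated W S2) W"

definition coxeter_irreducible :: "('a, 'b) monoid_scheme \<Rightarrow> 'a set \<Rightarrow> bool" where
  "coxeter_irreducible W S \<longleftrightarrow>
     \<not> (\<exists>S1 S2. S1 \<noteq> {} \<and> S2 \<noteq> {} \<and> S1 \<inter> S2 = {} \<and> S1 \<union> S2 = S \<and> internal_direct_sum W S1 S2)"

definition positive_definite :: "('a, 'b) monoid_scheme \<Rightarrow> ('a \<Rightarrow> complex) \<Rightarrow> bool" where
  "positive_definite G \<tau> \<longleftrightarrow>
     (\<forall>F c. finite F \<and> F \<subseteq> carrier G \<longrightarrow>
        (\<Sum>g\<in>F. \<Sum>h\<in>F. cnj (c g) * c h * \<tau> (inv\<^bsub>G\<^esub> g \<otimes>\<^bsub>G\<^esub> h)) \<in> \<real>\<^sub>\<ge>\<^sub>0)"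

text \<open>Functions on \<open>G\<close> are represented by their extensional representatives (\<open>undefined\<close> off the
  carrier), so that equality of characters is equality on the group.\<close>

definition characters :: "('a, 'b) monoid_scheme \<Rightarrow> ('a \<Rightarrow> complex) set" where
  "characters G =
     {\<tau> \<in> extensional (carrier G).
        positive_definite G \<tau> \<and>
        (\<forall>g\<in>carrier G. \<forall>h\<in>carrier G. \<tau> (h \<otimes>\<^bsub>G\<^esub> g \<otimes>\<^bsub>G\<^esub> inv\<^bsub>G\<^esub> h) = \<tau> g) \<and>
        \<tau> \<one>\<^bsub>G\<^esub> = 1}"

text \<open>The topology of pointwise convergence.\<close>

definition character_topology :: "('a, 'b) monoid_scheme \<Rightarrow> ('a \<Rightarrow> complex) topology" where
  "character_topology G =
     subtopology (product_topology (\<lambda>_. euclidean) (carrier G)) (characters G)"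

text \<open>Extremality as in \<^const>\<open>extreme_point_of\<close>, which is not applicable because the function type is
  not an instance of \<^class>\<open>real_vector\<close>.\<close>

definition extremal_characters :: "('a, 'b) monoid_scheme \<Rightarrow> ('a \<Rightarrow> complex) set" where
  "extremal_characters G =
     {\<tau> \<in> characters G.
        \<not> (\<exists>\<phi>\<in>characters G. \<exists>\<psi>\<in>characters G. \<exists>u::real.
             \<phi> \<noteq> \<psi> \<and> 0 < u \<and> u < 1 \<and>
             (\<forall>g\<in>carrier G. \<tau> g = (1 - u) *\<^sub>R \<phi> g + u *\<^sub>R \<psi> g))}"

definition regular_trace :: "('a, 'b) monoid_scheme \<Rightarrow> 'a \<Rightarrow> complex" where
  "regular_trace G = (\<lambda>g\<in>carrier G. if g = \<one>\<^bsub>G\<^esub> then 1 else 0)"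

definition euclidean_ball :: "nat \<Rightarrow> (nat \<Rightarrow> real) topology" where
  "euclidean_ball n = subtopology (Euclidean_space n) {x. (\<Sum>i<n. x i ^ 2) \<le> 1}"

definition euclidean_ball_interior :: "nat \<Rightarrow> (nat \<Rightarrow> real) set" where
  "euclidean_ball_interior n = {x \<in> topspace (Euclidean_space n). (\<Sum>i<n. x i ^ 2) < 1}"

text \<open>\<open>h\<close> exhibits the subset \<open>E\<close> of \<open>X\<close> as an \<open>n\<close>-dimensional Euclidean subspace; its interior is
  then \<open>h ` euclidean_ball_interior n\<close>.\<close>

definition euclidean_subspace_via ::
  "'x topology \<Rightarrow> nat \<Rightarrow> 'x set \<Rightarrow> ((nat \<Rightarrow> real) \<Rightarrow> 'x) \<Rightarrow> bool" where
  "euclidean_subspace_via X n E h \<longleftrightarrow>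
     E \<subseteq> topspace X \<and> homeomorphic_map (euclidean_ball n) (subtopology X E) h"

end

theory Submission
  imports Defs
begin

text \<open>
  Why the theorem holds. Since \<open>W\<close> is right-angled, a representation of \<open>W\<close> is nothing but a family of
  involutions indexed by \<open>S\<close> in which certain pairs commute, and such a family can be deformed. For a
  vector \<open>a\<close> of real numbers \<open>\<bar>a s\<bar> < 1\<close> let \<open>s\<close> act on functions on \<open>W\<close> by the reflection matrix with
  rows \<open>(a, b)\<close>, \<open>(b, -a)\<close>, where \<open>b = sqrt (1 - a\<^sup>2)\<close>, on every pair \<open>{w, s w}\<close> with \<open>w\<close> the shorter
  element. This is the regular representation for \<open>a = 0\<close> and, up to an affine change of generators,
  the left regular representation of a multiparameter Hecke algebra in general. The same construction
  on the right commutes with it, so the vector state \<open>\<chi>\<^sub>a\<close> of the point mass at \<open>\<one>\<close> is a character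
  (\<open>deformed_trace_character\<close>). It depends continuously on \<open>a\<close> and \<open>\<chi>\<^sub>a(s) = a s\<close>, so a small ball of
  parameters is embedded, with the regular trace as the image of its centre. It remains to see that
  \<open>\<chi>\<^sub>a\<close> is extremal for small \<open>a\<close>.

  Suppose \<open>\<chi>\<^sub>a = (1 - u) \<phi> + u \<psi>\<close>. Then \<open>\<psi>\<close> is dominated by a multiple of \<open>\<chi>\<^sub>a\<close>, so it is given by
  a square summable function \<open>\<xi>\<close> on \<open>W\<close>, and conjugation invariance of \<open>\<psi>\<close> says that left and right
  generators agree on \<open>\<xi>\<close> (\<open>convex_part_vector\<close>). For \<open>a = 0\<close> this means that \<open>\<xi>\<close> is constant on
  conjugacy classes; for small \<open>a\<close> it means that \<open>\<bar>\<xi>\<bar>\<^sup>2\<close>, restricted to \<open>W - {\<one>}\<close>, is a finite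
  measure that changes little under conjugation by generators
  (\<open>central_vector_almost_invariant\<close>). There is no such measure except \<open>0\<close> (\<open>spectral_gap\<close>). Hence
  \<open>\<xi>\<close> is a multiple of the point mass at \<open>\<one>\<close>, and \<open>\<psi> = \<chi>\<^sub>a = \<phi>\<close>.

  The spectral gap is a quantitative form of non-inner-amenability and is where irreducibility and
  \<open>\<bar>S\<bar> \<ge> 3\<close> enter. Call \<open>g\<close> generic for \<open>t \<in> S\<close> if \<open>t\<close> is neither a left nor a right descent of \<open>g\<close> and
  does not commute with \<open>g\<close>. If \<open>v\<close> is a walk in the graph of non-commuting generators that ends in \<open>t\<close>,
  nothing cancels in \<open>v g v\<^sup>-\<^sup>1\<close>, so this element begins with \<open>v\<close>; a vertex with two neighbours
  yields infinitely many walks whose initial segments exclude each other, hence infinitely many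
  disjoint conjugates of the set of generic elements (\<open>walks_disjoint\<close>), which therefore has almost
  no mass. Finally every \<open>g \<noteq> \<one>\<close> is generic for some \<open>t\<close>, possibly after conjugation by one generator
  (\<open>exists_generic_conjugate\<close>).
\<close>

section \<open>Words and actions of a right-angled Coxeter group\<close>

locale racg = group W for W :: "('a, 'b) monoid_scheme" (structure) +
  fixes S :: "'a set" and m :: "'a \<Rightarrow> 'a \<Rightarrow> enat"
  assumes system: "right_angled_coxeter_system W S m"
begin

lemma S_carrier: "s \<in> S \<Longrightarrow> s \<in> carrier W"
  using system by (auto simp: right_angled_coxeter_system_def presented_by_def)

lemma generate_S: "generate W S = carrier W"
  using system by (auto simp: right_angled_coxeter_system_def presented_by_def)

lemma m_diag: "s \<in> S \<Longrightarrow> m s s = 1"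
  using system by (auto simp: right_angled_coxeter_system_def)

lemma m_cases: "s \<in> S \<Longrightarrow> t \<in> S \<Longrightarrow> s \<noteq> t \<Longrightarrow> m s t = 2 \<or> m s t = \<infinity>"
  using system by (auto simp: right_angled_coxeter_system_def)

lemma value_one_iff:
  "w \<in> words_over S \<Longrightarrow> word_value W w = \<one> \<longleftrightarrow> word_equiv S (coxeter_relators S m) w []"
  using system by (auto simp: right_angled_coxeter_system_def presented_by_def)

definition wval :: "'a list \<Rightarrow> 'a" where
  "wval xs = foldr (\<otimes>) xs \<one>"

lemma wval_simps [simp]: "wval [] = \<one>" "wval (x # xs) = x \<otimes> wval xs"
  by (simp_all add: wval_def)

lemma wval_closed [simp]: "xs \<in> lists S \<Longrightarrow> wval xs \<in> carrier W"
  by (induction xs) (auto simp: S_carrier)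

lemma wval_closed_set [simp]: "\<forall>x\<in>set xs. x \<in> S \<Longrightarrow> wval xs \<in> carrier W"
  by (rule wval_closed) auto

lemma wval_append: "xs \<in> lists S \<Longrightarrow> ys \<in> lists S \<Longrightarrow> wval (xs @ ys) = wval xs \<otimes> wval ys"
  by (induction xs) (auto simp: S_carrier m_assoc)

definition positive :: "'a list \<Rightarrow> 'a word" where
  "positive xs = map (\<lambda>s. (s, True)) xs"

lemma word_value_positive: "word_value W (positive xs) = wval xs"
  by (induction xs) (auto simp: word_value_def positive_def letter_value_def)

lemma positive_words: "xs \<in> lists S \<Longrightarrow> positive xs \<in> words_over S"
  by (auto simp: positive_def words_over_def)

lemma relation_value:
  assumes "s \<in> S" "t \<in> S" "m s t = enat k"
  shows "wval (concat (replicate k [s, t])) = \<one>"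
proof -
  let ?r = "concat (replicate k [(s, True), (t, True)])"
  have r: "?r = positive (concat (replicate k [s, t]))"
    by (induction k) (auto simp: positive_def)
  have "concat (replicate k [s, t]) \<in> lists S"
    using assms by (auto simp: in_lists_conv_set)
  moreover have "word_equiv S (coxeter_relators S m) ([] @ ?r @ []) ([] @ [])"
    by (rule word_equiv.relator) (use assms in \<open>auto simp: coxeter_relators_def\<close>)
  ultimately show ?thesis
    using value_one_iff[of ?r] positive_words word_value_positive r by auto
qed

lemma S_square: "s \<in> S \<Longrightarrow> s \<otimes> s = \<one>"
  using relation_value[of s s 1] m_diag S_carrier by (simp add: one_enat_def)

lemma S_inv [simp]: "s \<in> S \<Longrightarrow> inv s = s"
  using S_square S_carrier by (simp add: inv_equality)

lemma S_cancel [simp]: "s \<in> S \<Longrightarrow> x \<in> carrier W \<Longrightarrow> s \<otimes> (s \<otimes> x) = x"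
  using S_square S_carrier by (simp flip: m_assoc)

lemma S_cancel_right [simp]: "s \<in> S \<Longrightarrow> x \<in> carrier W \<Longrightarrow> x \<otimes> s \<otimes> s = x"
  using S_square S_carrier by (simp add: m_assoc)

lemma commute_if_two:
  assumes "s \<in> S" "t \<in> S" "m s t = 2"
  shows "s \<otimes> t = t \<otimes> s"
proof -
  have c: "s \<in> carrier W" "t \<in> carrier W" using assms S_carrier by auto
  have "m s t = enat 2" using assms by (metis numeral_eq_enat)
  then have "s \<otimes> (t \<otimes> (s \<otimes> t)) = \<one>"
    using relation_value[of s t 2] assms c by (simp add: numeral_2_eq_2)
  then have "t \<otimes> (s \<otimes> (s \<otimes> (t \<otimes> (s \<otimes> t)))) = t \<otimes> (s \<otimes> \<one>)" by simp
  then show ?thesis using assms c by simp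
qed

text \<open>Inverses are superfluous because the generators are involutions; from here on, words are plain
  lists of generators.\<close>

lemma generate_eq_words:
  assumes "T \<subseteq> S"
  shows "generate W T = wval ` lists T"
proof
  have TS: "xs \<in> lists S" if "xs \<in> lists T" for xs using that assms by auto
  show "generate W T \<subseteq> wval ` lists T"
  proof
    fix x assume "x \<in> generate W T"
    then show "x \<in> wval ` lists T"
    proof induction
      case one
      show ?case by (rule image_eqI[of _ _ "[]"]) auto
    next
      case (incl h)
      then show ?case using assms S_carrier by (intro image_eqI[of _ _ "[h]"]) auto
    next
      case (inv h)
      then show ?case using assms S_carrier by (intro image_eqI[of _ _ "[h]"]) auto
    next
      case (eng h1 h2)
      then obtain xs ys where "xs \<in> lists T" "ys \<in> lists T" "h1 = wval xs" "h2 = wval ys" by auto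
      then show ?case by (intro image_eqI[of _ _ "xs @ ys"]) (auto simp: wval_append TS)
    qed
  qed
  have "wval xs \<in> generate W T" if "xs \<in> lists T" for xs
    using that by induction (auto intro: generate.one generate.incl generate.eng)
  then show "wval ` lists T \<subseteq> generate W T" by auto
qed

lemma obtain_word:
  assumes "g \<in> carrier W"
  obtains xs where "xs \<in> lists S" "wval xs = g"
  using assms generate_S generate_eq_words[of S] by (metis imageE subset_refl)

lemma W_induct [consumes 1, case_names one mult]:
  assumes "g \<in> carrier W" "P \<one>" "\<And>s g. s \<in> S \<Longrightarrow> g \<in> carrier W \<Longrightarrow> P g \<Longrightarrow> P (s \<otimes> g)"
  shows "P g"
proof -
  obtain xs where "xs \<in> lists S" "wval xs = g" using obtain_word assms(1) by blast
  moreover have "P (wval xs)" if "xs \<in> lists S" for xs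
    using that
  proof induction
    case (Cons x xs)
    then show ?case using assms(3)[of x "wval xs"] wval_closed by simp
  qed (use assms in simp)
  ultimately show ?thesis by blast
qed

text \<open>The universal property is stated for actions on an arbitrary type, not for homomorphisms into
  another group. It is used with four quite different targets: truth values, integers, sets of
  reflections, and functions on \<open>W\<close>.\<close>

definition compatible :: "('a \<Rightarrow> 'x \<Rightarrow> 'x) \<Rightarrow> bool" where
  "compatible f \<longleftrightarrow> (\<forall>s\<in>S. \<forall>x. f s (f s x) = x) \<and>
     (\<forall>s\<in>S. \<forall>t\<in>S. m s t = 2 \<longrightarrow> (\<forall>x. f s (f t x) = f t (f s x)))"

definition act :: "('a \<Rightarrow> 'x \<Rightarrow> 'x) \<Rightarrow> 'a \<Rightarrow> 'x \<Rightarrow> 'x" where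
  "act f g = foldr f (SOME xs. xs \<in> lists S \<and> wval xs = g)"

lemma word_equiv_foldr:
  assumes "compatible f" "word_equiv S (coxeter_relators S m) v w"
  shows "foldr (\<lambda>l. f (fst l)) v = foldr (\<lambda>l. f (fst l)) w"
  using assms(2)
proof induction
  case (cancel s u b v)
  then show ?case using assms(1) by (auto simp: compatible_def)
next
  case (relator r u v)
  then obtain s t k where r: "r = concat (replicate k [(s, True), (t, True)])"
    and st: "s \<in> S" "t \<in> S" "m s t = enat k" by (auto simp: coxeter_relators_def)
  have "foldr (\<lambda>l. f (fst l)) r x = x" for x
  proof (cases "s = t")
    case True
    then have "k = 1" using m_diag st by (simp add: one_enat_def)
    then show ?thesis using True r st assms(1) by (auto simp: compatible_def)
  next
    case False
    then have 2: "m s t = 2" using m_cases st by force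
    then have "k = 2" using st by (metis enat.inject numeral_eq_enat)
    then have "r = [(s, True), (t, True), (s, True), (t, True)]"
      by (simp add: r numeral_2_eq_2)
    then show ?thesis using st 2 assms(1) unfolding compatible_def by (simp del: all_simps) metis
  qed
  then show ?case by auto
qed auto

text \<open>Two words with the same value act alike since \<open>xs\<close> followed by the reverse of \<open>ys\<close> is a word for
  \<open>\<one>\<close>, which the presentation reduces to the empty word.\<close>

lemma foldr_eq:
  assumes f: "compatible f" and xs: "xs \<in> lists S" and ys: "ys \<in> lists S"
    and eq: "wval xs = wval ys"
  shows "foldr f xs = foldr f ys"
proof -
  have rev_inv: "wval (rev ys) = inv (wval ys)" if "ys \<in> lists S" for ys
    using that by induction (auto simp: wval_append inv_mult_group S_carrier in_lists_conv_set)
  have rys: "rev ys \<in> lists S" using ys by (simp add: in_lists_conv_set)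
  have "wval (xs @ rev ys) = \<one>"
    using xs ys rys eq by (simp add: wval_append rev_inv)
  then have "word_equiv S (coxeter_relators S m) (positive (xs @ rev ys)) []"
    using value_one_iff[of "positive (xs @ rev ys)"] xs rys
    by (simp add: positive_words word_value_positive)
  then have "foldr (\<lambda>l. f (fst l)) (positive (xs @ rev ys)) = id"
    using word_equiv_foldr[OF f] by force
  moreover have "foldr (\<lambda>l. f (fst l)) (positive zs) = foldr f zs" for zs
    by (induction zs) (auto simp: positive_def)
  ultimately have id: "foldr f xs (foldr f (rev ys) x) = x" for x
    by (metis comp_apply foldr_append id_apply)
  have "foldr f (rev ys) (foldr f ys x) = x" for x
    using ys by (induction arbitrary: x) (use f in \<open>auto simp: compatible_def\<close>)
  then show ?thesis using id by (metis ext)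
qed

lemma act_wval:
  assumes "compatible f" "xs \<in> lists S"
  shows "act f (wval xs) = foldr f xs"
  unfolding act_def
  by (rule foldr_eq[OF assms(1) _ assms(2)]) (use someI_ex[of "\<lambda>ys. ys \<in> lists S \<and> wval ys = wval xs"] assms in auto)

lemma act_one: "compatible f \<Longrightarrow> act f \<one> x = x"
  using act_wval[of f "[]"] by simp

lemma act_step:
  assumes "compatible f" "s \<in> S" "g \<in> carrier W"
  shows "act f (s \<otimes> g) x = f s (act f g x)"
proof -
  obtain xs where "xs \<in> lists S" "wval xs = g" using obtain_word assms(3) by blast
  then show ?thesis using assms act_wval[of f xs] act_wval[of f "s # xs"] by simp
qed

lemma act_gen: "compatible f \<Longrightarrow> s \<in> S \<Longrightarrow> act f s x = f s x"
  using act_step[of f s \<one> x] by (simp add: act_one S_carrier)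

lemma act_mult:
  assumes "compatible f" "g \<in> carrier W" "h \<in> carrier W"
  shows "act f (g \<otimes> h) x = act f g (act f h x)"
  using assms(2) by (induction rule: W_induct) (use assms in \<open>auto simp: act_one act_step m_assoc S_carrier\<close>)

text \<open>The sign character that is \<open>-1\<close> on \<open>s\<close> and \<open>1\<close> on all other generators separates the conjugacy
  classes of distinct generators.\<close>

lemma S_conjugate_eq:
  assumes "s \<in> S" "t \<in> S" "w \<in> carrier W" "s \<otimes> w = w \<otimes> t"
  shows "s = t"
proof (rule ccontr)
  assume "s \<noteq> t"
  define f :: "'a \<Rightarrow> bool \<Rightarrow> bool" where "f x = (if x = s then Not else (\<lambda>b. b))" for x
  have f: "compatible f" by (auto simp: compatible_def f_def)
  have "act f (s \<otimes> w) True = f s (act f w True)" by (rule act_step[OF f assms(1,3)])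
  then have "act f (s \<otimes> w) True \<longleftrightarrow> \<not> act f w True" by (simp only: f_def simp_thms if_True)
  moreover have "act f (w \<otimes> t) True = act f w (act f t True)" by (rule act_mult[OF f assms(3) S_carrier[OF assms(2)]])
  moreover have "act f t True = True" unfolding act_gen[OF f assms(2)] using \<open>s \<noteq> t\<close> by (simp add: f_def)
  ultimately show False unfolding assms(4) by simp
qed

section \<open>The reflection cocycle\<close>

text \<open>A word is traced by the set of reflections \<open>r\<close> whose walls it crosses an odd number of times:
  prepending \<open>s\<close> turns such a set \<open>A\<close> into the symmetric difference of \<open>{s}\<close> and \<open>s A s\<close>. Elements
  outside the carrier are left alone, so that the step is an involution on all sets.\<close>

definition reflection_step :: "'a \<Rightarrow> 'a set \<Rightarrow> 'a set" where
  "reflection_step s A = {r. if r \<in> carrier W then (r = s) \<noteq> (s \<otimes> r \<otimes> s \<in> A) else r \<in> A}"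

lemma S_conj_conj: "s \<in> S \<Longrightarrow> r \<in> carrier W \<Longrightarrow> s \<otimes> (s \<otimes> r \<otimes> s) \<otimes> s = r"
  by (simp add: S_carrier m_assoc S_square)

lemma S_conj_eq_iff:
  assumes "s \<in> S" "r \<in> carrier W" "x \<in> carrier W"
  shows "s \<otimes> r \<otimes> s = x \<longleftrightarrow> r = s \<otimes> x \<otimes> s"
  using S_conj_conj[OF assms(1,2)] S_conj_conj[OF assms(1,3)] by auto

lemma compatible_reflection_step: "compatible reflection_step"
  unfolding compatible_def
proof (intro conjI ballI impI allI)
  fix s A assume s: "s \<in> S"
  then have c: "s \<in> carrier W" by (rule S_carrier)
  show "reflection_step s (reflection_step s A) = A"
  proof (rule Set.set_eqI)
    fix r
    have "r \<in> reflection_step s (reflection_step s A) \<longleftrightarrow>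
        (r = s) \<noteq> ((s \<otimes> r \<otimes> s = s) \<noteq> (r \<in> A))" if "r \<in> carrier W"
      using that c by (simp only: reflection_step_def mem_Collect_eq m_closed if_True S_conj_conj[OF s that])
    moreover have "s \<otimes> r \<otimes> s = s \<longleftrightarrow> r = s" if "r \<in> carrier W"
      using S_conj_eq_iff[OF s that c] s c by simp
    ultimately show "r \<in> reflection_step s (reflection_step s A) \<longleftrightarrow> r \<in> A"
      by (cases "r \<in> carrier W") (auto simp: reflection_step_def)
  qed
next
  fix s t A assume s: "s \<in> S" and t: "t \<in> S" and 2: "m s t = 2"
  then have c: "s \<in> carrier W" "t \<in> carrier W" by (auto intro: S_carrier)
  have st: "s \<otimes> t = t \<otimes> s" by (rule commute_if_two[OF s t 2])
  have fix1: "s \<otimes> t \<otimes> s = t" unfolding st using s c by simp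
  have fix2: "t \<otimes> s \<otimes> t = s" unfolding st[symmetric] using t c by simp
  have eq: "t \<otimes> (s \<otimes> r \<otimes> s) \<otimes> t = s \<otimes> (t \<otimes> r \<otimes> t) \<otimes> s" if r: "r \<in> carrier W" for r
  proof -
    have "t \<otimes> (s \<otimes> r \<otimes> s) \<otimes> t = (t \<otimes> s) \<otimes> r \<otimes> (s \<otimes> t)" using c r by (simp add: m_assoc)
    also have "\<dots> = (s \<otimes> t) \<otimes> r \<otimes> (t \<otimes> s)" by (simp only: st)
    finally show ?thesis using c r by (simp add: m_assoc)
  qed
  show "reflection_step s (reflection_step t A) = reflection_step t (reflection_step s A)"
  proof (rule Set.set_eqI)
    fix r
    have "s \<otimes> r \<otimes> s = t \<longleftrightarrow> r = t" "t \<otimes> r \<otimes> t = s \<longleftrightarrow> r = s" if "r \<in> carrier W"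
      using S_conj_eq_iff[OF s that c(2)] S_conj_eq_iff[OF t that c(1)] by (simp_all only: fix1 fix2)
    then have "r \<in> reflection_step s (reflection_step t A) \<longleftrightarrow>
        (r = s) \<noteq> ((r = t) \<noteq> (t \<otimes> (s \<otimes> r \<otimes> s) \<otimes> t \<in> A))"
      and "r \<in> reflection_step t (reflection_step s A) \<longleftrightarrow>
        (r = t) \<noteq> ((r = s) \<noteq> (s \<otimes> (t \<otimes> r \<otimes> t) \<otimes> s \<in> A))" if "r \<in> carrier W"
      using that c by (simp_all only: reflection_step_def mem_Collect_eq m_closed if_True)
    moreover have "r \<in> reflection_step x B \<longleftrightarrow> r \<in> B" if "r \<notin> carrier W" for x B
      using that by (simp only: reflection_step_def mem_Collect_eq if_False)
    ultimately show "r \<in> reflection_step s (reflection_step t A) \<longleftrightarrow> r \<in> reflection_step t (reflection_step s A)"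
      using eq[of r] by (cases "r \<in> carrier W"; metis)
  qed
qed

text \<open>The set of left inversions of \<open>g\<close>. For generators, \<open>s \<in> N g\<close> says that \<open>s\<close> is a left descent of
  \<open>g\<close>, and \<open>s \<in> N (inv g)\<close> that it is a right descent; no length function is needed to speak of them.\<close>

definition N :: "'a \<Rightarrow> 'a set" where
  "N g = act reflection_step g {}"

lemma N_one [simp]: "N \<one> = {}"
  by (simp add: N_def act_one compatible_reflection_step)

lemma N_step:
  assumes "s \<in> S" "g \<in> carrier W" "r \<in> carrier W"
  shows "r \<in> N (s \<otimes> g) \<longleftrightarrow> (r = s) \<noteq> (s \<otimes> r \<otimes> s \<in> N g)"
  using assms by (simp add: N_def act_step compatible_reflection_step reflection_step_def)

lemma N_gen: "s \<in> S \<Longrightarrow> r \<in> carrier W \<Longrightarrow> r \<in> N s \<longleftrightarrow> r = s"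
  using N_step[of s \<one> r] S_carrier by simp

lemma N_mult:
  assumes "g \<in> carrier W" "h \<in> carrier W" "r \<in> carrier W"
  shows "r \<in> N (g \<otimes> h) \<longleftrightarrow> (r \<in> N g) \<noteq> (inv g \<otimes> r \<otimes> g \<in> N h)"
  using assms(1,3)
proof (induction arbitrary: r rule: W_induct)
  case (mult s g)
  have "inv (s \<otimes> g) \<otimes> r \<otimes> (s \<otimes> g) = inv g \<otimes> (s \<otimes> r \<otimes> s) \<otimes> g"
    using mult S_carrier by (simp add: inv_mult_group m_assoc)
  then show ?case
    using mult assms(2) by (auto simp: m_assoc S_carrier N_step)
qed (use assms in auto)

lemma N_inv:
  assumes "g \<in> carrier W" "r \<in> carrier W"
  shows "r \<in> N (inv g) \<longleftrightarrow> g \<otimes> r \<otimes> inv g \<in> N g"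
  using N_mult[of "inv g" g r] assms by simp

lemma desc_flip:
  assumes "s \<in> S" "g \<in> carrier W"
  shows "s \<in> N (s \<otimes> g) \<longleftrightarrow> s \<notin> N g"
  using assms N_step[of s g s] S_carrier S_square by simp

lemma desc_commute:
  assumes "s \<in> S" "t \<in> S" "s \<otimes> t = t \<otimes> s" "s \<noteq> t" "g \<in> carrier W"
  shows "s \<in> N (t \<otimes> g) \<longleftrightarrow> s \<in> N g"
proof -
  have "t \<otimes> s \<otimes> t = s" using assms S_carrier by (simp flip: assms(3))
  then show ?thesis using assms S_carrier by (simp add: N_step)
qed

text \<open>Right multiplication by \<open>t\<close> crosses the single wall of \<open>g t g\<^sup>-\<^sup>1\<close>, so it can affect the
  descent \<open>s\<close> only if this reflection is \<open>s\<close> itself.\<close>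

lemma desc_right:
  assumes "s \<in> S" "t \<in> S" "g \<in> carrier W"
  shows "s \<in> N (g \<otimes> t) \<longleftrightarrow> (s \<in> N g) \<noteq> (s \<otimes> g = g \<otimes> t)"
proof -
  have c: "s \<in> carrier W" "t \<in> carrier W" using assms S_carrier by auto
  have "inv g \<otimes> s \<otimes> g = t \<longleftrightarrow> s \<otimes> g = g \<otimes> t"
    using assms c by (metis inv_closed inv_solve_left m_assoc m_closed)
  then show ?thesis using assms c by (simp add: N_mult N_gen)
qed

text \<open>If \<open>r\<close> is an inversion, the word crosses its wall at some letter, and multiplication by \<open>r\<close>
  deletes that letter.\<close>

lemma strong_exchange:
  assumes "xs \<in> lists S" "r \<in> carrier W" "r \<in> N (wval xs)"
  shows "\<exists>ys \<in> lists S. length ys < length xs \<and> wval ys = r \<otimes> wval xs"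
  using assms
proof (induction xs arbitrary: r)
  case (Cons x xs)
  then have x: "x \<in> S" "x \<in> carrier W" "xs \<in> lists S" by (auto intro: S_carrier)
  show ?case
  proof (cases "r = x")
    case True
    then show ?thesis using x by (intro bexI[of _ xs]) auto
  next
    case False
    then have "x \<otimes> r \<otimes> x \<in> N (wval xs)" using Cons.prems x by (simp add: N_step)
    then obtain ys where ys: "ys \<in> lists S" "length ys < length xs" "wval ys = x \<otimes> r \<otimes> x \<otimes> wval xs"
      using Cons.IH[of "x \<otimes> r \<otimes> x"] x Cons.prems by auto
    then have "wval (x # ys) = r \<otimes> wval (x # xs)" using x Cons.prems by (simp add: m_assoc)
    moreover have "x # ys \<in> lists S" "length (x # ys) < length (x # xs)" using ys x by auto
    ultimately show ?thesis by blast
  qed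
qed (simp only: wval_simps N_one empty_iff)

lemma minimal_word:
  assumes "\<exists>xs\<in>lists S. P (wval xs)"
  obtains xs where "xs \<in> lists S" "P (wval xs)"
    "\<And>ys. ys \<in> lists S \<Longrightarrow> P (wval ys) \<Longrightarrow> length xs \<le> length ys"
proof -
  from assms obtain zs where "zs \<in> lists S \<and> P (wval zs)" by blast
  from ex_has_least_nat[of "\<lambda>xs. xs \<in> lists S \<and> P (wval xs)", OF this, of length]
  show ?thesis using that by metis
qed

lemma exists_descent:
  assumes "g \<in> carrier W" "g \<noteq> \<one>"
  shows "\<exists>s\<in>S. s \<in> N g"
proof -
  have "\<exists>xs\<in>lists S. wval xs = g" using obtain_word assms by blast
  then obtain xs where xs: "xs \<in> lists S" "wval xs = g"
    and min: "\<And>ys. ys \<in> lists S \<Longrightarrow> wval ys = g \<Longrightarrow> length xs \<le> length ys"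
    using minimal_word[of "\<lambda>x. x = g"] by metis
  obtain x zs where [simp]: "xs = x # zs" using xs assms by (cases xs) auto
  have x: "x \<in> S" "zs \<in> lists S" using xs by auto
  have "x \<in> N g"
  proof (rule ccontr)
    assume "x \<notin> N g"
    then have "x \<in> N (wval zs)" using xs x desc_flip[of x "wval zs"] by auto
    then show False using strong_exchange[of zs x] min xs x S_carrier by fastforce
  qed
  then show ?thesis using x by blast
qed

fun alt :: "'a \<Rightarrow> 'a \<Rightarrow> nat \<Rightarrow> 'a" where
  "alt s t 0 = \<one>"
| "alt s t (Suc n) = s \<otimes> alt t s n"

lemma alt_closed [simp]: "s \<in> S \<Longrightarrow> t \<in> S \<Longrightarrow> alt s t n \<in> carrier W"
  by (induction n arbitrary: s t) (auto intro: S_carrier)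

lemma alt_odd_conj:
  assumes "s \<in> S" "t \<in> S"
  shows "s \<otimes> alt t s (2 * k + 1) \<otimes> s = alt s t (2 * (k + 1) + 1)"
proof -
  have "alt t s (2 * k + 1) \<otimes> s = alt t s (2 * k + 2)" if "s \<in> S" "t \<in> S" for s t k
    using that by (induction k) (auto simp: m_assoc S_carrier)
  then show ?thesis using assms by (simp add: m_assoc S_carrier)
qed

lemma N_alt:
  assumes "s \<in> S" "t \<in> S" "r \<in> carrier W" "r \<in> N (alt s t n)"
  shows "\<exists>k. r = alt s t (2 * k + 1)"
  using assms
proof (induction n arbitrary: s t r)
  case (Suc n)
  show ?case
  proof (cases "r = s")
    case True
    then show ?thesis using Suc S_carrier by (intro exI[of _ 0]) auto
  next
    case False
    then have "s \<otimes> r \<otimes> s \<in> N (alt t s n)" using Suc.prems by (simp add: N_step)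
    then obtain k where "s \<otimes> r \<otimes> s = alt t s (2 * k + 1)"
      using Suc.IH[of t s "s \<otimes> r \<otimes> s"] Suc.prems S_carrier by auto
    then have "r = alt s t (2 * (k + 1) + 1)"
      using alt_odd_conj[of s t k] Suc.prems S_conj_conj by metis
    then show ?thesis by blast
  qed
qed simp

text \<open>The generators \<open>s\<close> and \<open>t\<close> act on the integers by the reflections \<open>z \<mapsto> -z\<close> and
  \<open>z \<mapsto> 1 - z\<close>, all other generators trivially; the infinite dihedral group is visible there.\<close>

lemma gen_neq_alt:
  assumes "s \<in> S" "t \<in> S" "s \<otimes> t \<noteq> t \<otimes> s"
  shows "t \<noteq> alt s t (2 * k + 1)"
proof
  assume eq: "t = alt s t (2 * k + 1)"
  define f :: "'a \<Rightarrow> int \<Rightarrow> int" where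
    "f x = (if x = s then uminus else if x = t then (\<lambda>z. 1 - z) else (\<lambda>z. z))" for x
  have st: "s \<noteq> t" using assms by auto
  have m2: "m s t \<noteq> 2" "m t s \<noteq> 2" using assms commute_if_two by metis+
  have f: "compatible f" using m2 by (auto simp: compatible_def f_def)
  have fs: "f s z = - z" "f t z = 1 - z" for z using st by (auto simp: f_def)
  have "act f (alt s t (2 * k + 1)) z = - z - int k" for z
    by (induction k) (use assms fs f in \<open>auto simp: act_step act_one act_gen S_carrier\<close>)
  then have "act f t 0 = - int k" by (simp only: flip: eq) 
  then show False using assms f fs by (simp add: act_gen)
qed

lemma dihedral_word:
  assumes "xs \<in> lists {s, t}" "s \<in> S" "t \<in> S"
  shows "\<exists>n. wval xs = alt s t n \<or> wval xs = alt t s n"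
  using assms(1)
proof (induction xs)
  case Nil
  show ?case by (intro exI[of _ 0]) simp
next
  case (Cons x xs)
  then obtain n where n: "wval xs = alt s t n \<or> wval xs = alt t s n" by auto
  have shift: "\<exists>n'. x \<otimes> alt x y n = alt x y n' \<or> x \<otimes> alt x y n = alt y x n'" if "x \<in> S" "y \<in> S" for x y
  proof (cases n)
    case 0
    then show ?thesis using that S_carrier by (intro exI[of _ 1]) auto
  next
    case (Suc k)
    then show ?thesis using that by (intro exI[of _ k]) auto
  qed
  have grow: "x \<otimes> alt y x n = alt x y (Suc n)" for x y by simp
  have "x = s \<or> x = t" using Cons by auto
  then show ?case
    using n shift[of s t] shift[of t s] grow[of s t] grow[of t s] assms by (metis wval_simps(2))
qed

text \<open>The only fact about descents that is special to the right-angled case. Write \<open>g = h\<^sup>-\<^sup>1 x\<close> with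
  \<open>h\<close> in the subgroup \<open>H\<close> generated by \<open>s\<close> and \<open>t\<close> and \<open>x\<close> of minimal word length in its coset.
  By the exchange condition \<open>x\<close> has no inversion in \<open>H\<close>, so both descents are already
  descents of \<open>h\<^sup>-\<^sup>1\<close>. But the inversions of an alternating word are alternating words with the same
  first letter.\<close>

lemma desc_exclusive:
  assumes s: "s \<in> S" and t: "t \<in> S" and nc: "s \<otimes> t \<noteq> t \<otimes> s" and g: "g \<in> carrier W"
  shows "\<not> (s \<in> N g \<and> t \<in> N g)"
proof
  assume both: "s \<in> N g \<and> t \<in> N g"
  let ?H = "generate W {s, t}"
  have H: "subgroup ?H W" using s t S_carrier by (intro generate_is_subgroup) auto
  interpret H: subgroup ?H W by (rule H)
  have stH: "s \<in> ?H" "t \<in> ?H" by (auto intro: generate.incl)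
  have "\<exists>xs\<in>lists S. \<exists>h\<in>?H. wval xs = h \<otimes> g"
    using obtain_word[OF g] g H.one_closed by (metis l_one)
  then obtain xs where xs: "xs \<in> lists S" "\<exists>h\<in>?H. wval xs = h \<otimes> g"
    and min: "\<And>ys. ys \<in> lists S \<Longrightarrow> \<exists>h\<in>?H. wval ys = h \<otimes> g \<Longrightarrow> length xs \<le> length ys"
    using minimal_word[of "\<lambda>x. \<exists>h\<in>?H. x = h \<otimes> g"] by blast
  then obtain h where h: "h \<in> ?H" "wval xs = h \<otimes> g" by blast
  have hc: "h \<in> carrier W" using h H.mem_carrier by blast
  have none: "r \<notin> N (wval xs)" if r: "r \<in> ?H" for r
  proof
    assume "r \<in> N (wval xs)"
    then obtain ys where ys: "ys \<in> lists S" "length ys < length xs" "wval ys = r \<otimes> wval xs"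
      using strong_exchange[OF xs(1) H.mem_carrier[OF r]] by blast
    have "wval ys = (r \<otimes> h) \<otimes> g" using ys h hc g r H.mem_carrier by (simp add: m_assoc)
    then show False using min[of ys] ys h r H.m_closed by fastforce
  qed
  have g_eq: "g = inv h \<otimes> wval xs" using h hc g by (simp flip: m_assoc)
  have descs: "x \<in> N (inv h)" if "x \<in> {s, t}" for x
  proof -
    have x: "x \<in> ?H" "x \<in> carrier W" "x \<in> N g" using that stH s t S_carrier both by auto
    have "h \<otimes> x \<otimes> inv h \<in> ?H" using h x H.m_closed H.m_inv_closed by blast
    then have "h \<otimes> x \<otimes> inv h \<notin> N (wval xs)" by (rule none)
    then show ?thesis using x hc xs N_mult[of "inv h" "wval xs" x] g_eq by simp
  qed
  have "inv h \<in> wval ` lists {s, t}"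
    using H.m_inv_closed[OF h(1)] generate_eq_words[of "{s, t}"] s t by auto
  then obtain ys where "ys \<in> lists {s, t}" "inv h = wval ys" by auto
  then obtain n where "inv h = alt s t n \<or> inv h = alt t s n"
    using dihedral_word[of ys s t] s t by auto
  then show False
  proof
    assume "inv h = alt s t n"
    then show False using descs[of t] N_alt[of s t t n] gen_neq_alt[of s t] s t nc S_carrier by auto
  next
    assume "inv h = alt t s n"
    then show False using descs[of s] N_alt[of t s s n] gen_neq_alt[of t s] s t nc S_carrier by auto
  qed
qed

section \<open>Irreducibility and the non-commutation graph\<close>

definition noncomm :: "'a rel" where
  "noncomm = {(s, t). s \<in> S \<and> t \<in> S \<and> s \<otimes> t \<noteq> t \<otimes> s}"

lemma commuting_generators:
  assumes "A \<subseteq> S" "B \<subseteq> S" "\<And>a b. a \<in> A \<Longrightarrow> b \<in> B \<Longrightarrow> a \<otimes> b = b \<otimes> a"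
    and x: "x \<in> generate W A" and y: "y \<in> generate W B"
  shows "x \<otimes> y = y \<otimes> x"
proof -
  have comm: "z \<otimes> wval xs = wval xs \<otimes> z"
    if "T \<subseteq> S" "xs \<in> lists T" "z \<in> carrier W" "\<And>a. a \<in> T \<Longrightarrow> z \<otimes> a = a \<otimes> z" for z T xs
    using that(2)
  proof induction
    case (Cons a xs)
    then have "a \<in> S" "xs \<in> lists S" using that(1) by auto
    then have c: "a \<in> carrier W" "wval xs \<in> carrier W" using S_carrier by auto
    have "z \<otimes> (a \<otimes> wval xs) = a \<otimes> (z \<otimes> wval xs)"
      using that(3) that(4)[OF Cons.hyps(1)] c by (simp flip: m_assoc)
    also have "\<dots> = a \<otimes> (wval xs \<otimes> z)" using Cons.IH by simp
    finally show ?case using that(3) c by (simp add: m_assoc)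
  qed (use that in simp)
  obtain xs where xs: "xs \<in> lists A" "x = wval xs" using x unfolding generate_eq_words[OF assms(1)] by auto
  obtain ys where ys: "ys \<in> lists B" "y = wval ys" using y unfolding generate_eq_words[OF assms(2)] by auto
  have c: "xs \<in> lists S" "ys \<in> lists S" using xs ys assms by auto
  have "a \<otimes> y = y \<otimes> a" if "a \<in> A" for a
    unfolding ys(2) by (rule comm[OF assms(2) ys(1)]) (use that assms S_carrier in auto)
  then have "y \<otimes> x = x \<otimes> y"
    unfolding xs(2) by (intro comm[OF assms(1) xs(1)]) (use c ys wval_closed in auto)
  then show ?thesis by simp
qed

text \<open>An element of both subgroups is recovered from its word in \<open>A\<close> and erased from its word in \<open>B\<close>
  by the action in which the letters outside \<open>A\<close> do nothing.\<close>

lemma disjoint_parabolics: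
  assumes "A \<subseteq> S" "B \<subseteq> S" "A \<inter> B = {}"
  shows "generate W A \<inter> generate W B = {\<one>}"
proof -
  define f where "f s z = (if s \<in> A \<and> z \<in> carrier W then s \<otimes> z else z)" for s z
  have f: "compatible f"
    unfolding compatible_def f_def
  proof (intro conjI ballI impI allI)
    fix s t z assume st: "s \<in> S" "t \<in> S" "m s t = 2"
    have c: "s \<in> carrier W" "t \<in> carrier W" using st S_carrier by auto
    have "s \<otimes> (t \<otimes> z) = t \<otimes> (s \<otimes> z)" if "z \<in> carrier W"
      using commute_if_two[OF st] that c by (simp flip: m_assoc)
    then show "(if s \<in> A \<and> (if t \<in> A \<and> z \<in> carrier W then t \<otimes> z else z) \<in> carrier W
        then s \<otimes> (if t \<in> A \<and> z \<in> carrier W then t \<otimes> z else z)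
        else if t \<in> A \<and> z \<in> carrier W then t \<otimes> z else z) =
       (if t \<in> A \<and> (if s \<in> A \<and> z \<in> carrier W then s \<otimes> z else z) \<in> carrier W
        then t \<otimes> (if s \<in> A \<and> z \<in> carrier W then s \<otimes> z else z)
        else if s \<in> A \<and> z \<in> carrier W then s \<otimes> z else z)"
      using c by (auto split: if_splits)
  qed (use S_carrier in auto)
  have one: "z = \<one>" if zA: "z \<in> generate W A" and zB: "z \<in> generate W B" for z
  proof -
    obtain xs where xs: "xs \<in> lists A" "z = wval xs" using zA unfolding generate_eq_words[OF assms(1)] by auto
    obtain ys where ys: "ys \<in> lists B" "z = wval ys" using zB unfolding generate_eq_words[OF assms(2)] by auto
    have c: "xs \<in> lists S" "ys \<in> lists S" using xs ys assms by auto
    have "foldr f xs \<one> = wval xs"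
      using xs(1)
    proof induction
      case (Cons a xs)
      then have "xs \<in> lists S" using assms(1) by auto
      then show ?case using Cons by (simp add: f_def)
    qed simp
    moreover have "foldr f ys \<one> = \<one>"
      using ys(1)
    proof induction
      case (Cons a ys)
      then show ?case using assms(3) by (auto simp: f_def)
    qed simp
    ultimately show ?thesis using act_wval[OF f c(1)] act_wval[OF f c(2)] xs ys by simp
  qed
  show ?thesis
  proof (intro equalityI subsetI)
    fix z assume "z \<in> generate W A \<inter> generate W B"
    then show "z \<in> {\<one>}" using one[of z] by simp
  qed (simp add: generate.one)
qed

lemma commuting_parts_direct_sum:
  assumes S12: "A \<union> B = S" "A \<inter> B = {}"
    and comm: "\<And>a b. a \<in> A \<Longrightarrow> b \<in> B \<Longrightarrow> a \<otimes> b = b \<otimes> a"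
  shows "internal_direct_sum W A B"
proof -
  have sub: "A \<subseteq> S" "B \<subseteq> S" "A \<subseteq> carrier W" "B \<subseteq> carrier W" using S12 S_carrier by auto
  interpret A: subgroup "generate W A" W using sub by (simp add: generate_is_subgroup)
  interpret B: subgroup "generate W B" W using sub by (simp add: generate_is_subgroup)
  interpret group_disjoint_sum W "generate W A" "generate W B" ..
  have eq: "subgroup_generated W T = subgroup_generated W (generate W T)" if "T \<subseteq> carrier W" for T
  proof -
    interpret T: subgroup "generate W T" W using that by (simp add: generate_is_subgroup)
    show ?thesis
      using T.carrier_subgroup_generated_subgroup Int_absorb1[OF that]
      unfolding carrier_subgroup_generated subgroup_generated_def by simp
  qed
  have comm_gen: "x \<otimes> y = y \<otimes> x" if "x \<in> generate W A" "y \<in> generate W B" for x y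
    by (rule commuting_generators[OF sub(1,2) _ that]) (rule comm)
  have prodI: "x \<otimes> y \<in> generate W A <#> generate W B"
    if "x \<in> generate W A" "y \<in> generate W B" for x y
    using that unfolding set_mult_def by auto
  have g: "g \<in> generate W A <#> generate W B" if "g \<in> carrier W" for g
    using that
  proof (induction rule: W_induct)
    case one
    have "\<one> \<otimes> \<one> \<in> generate W A <#> generate W B"
      by (intro prodI generate.one)
    then show ?case by simp
  next
    case (mult s g)
    then obtain x y where xy: "x \<in> generate W A" "y \<in> generate W B" "g = x \<otimes> y"
      unfolding set_mult_def by auto
    then have c: "x \<in> carrier W" "y \<in> carrier W" "s \<in> carrier W" using mult S_carrier by auto
    show ?case
    proof (cases "s \<in> A")
      case True
      then have "s \<otimes> x \<in> generate W A" using xy by (intro A.m_closed) (auto intro: generate.incl)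
      moreover have "s \<otimes> g = (s \<otimes> x) \<otimes> y" using c xy by (simp add: m_assoc)
      ultimately show ?thesis using prodI xy by metis
    next
      case False
      then have s: "s \<in> generate W B" using mult S12 by (auto intro: generate.incl)
      then have "s \<otimes> y \<in> generate W B" using xy by (intro B.m_closed) auto
      moreover have "x \<otimes> s = s \<otimes> x" by (rule comm_gen[OF xy(1) s])
      then have "s \<otimes> g = x \<otimes> (s \<otimes> y)" using c xy by (simp flip: m_assoc)
      ultimately show ?thesis using prodI xy by metis
    qed
  qed
  have "generate W A <#> generate W B \<subseteq> carrier W"
    by (intro set_mult_closed) auto
  then have "generate W A <#> generate W B = carrier W" using g by auto
  then show ?thesis
    unfolding internal_direct_sum_def eq[OF sub(3)] eq[OF sub(4)] iso_group_mul_alt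
    by (intro conjI ballI disjoint_parabolics[OF sub(1,2) S12(2)] comm_gen)
qed

lemma noncomm_connected:
  assumes irr: "coxeter_irreducible W S" and xy: "x \<in> S" "y \<in> S"
  shows "(x, y) \<in> noncomm\<^sup>*"
proof (rule ccontr)
  assume no: "(x, y) \<notin> noncomm\<^sup>*"
  define A where "A = {z \<in> S. (x, z) \<in> noncomm\<^sup>*}"
  have "a \<otimes> b = b \<otimes> a" if "a \<in> A" "b \<in> S - A" for a b
    using that unfolding A_def noncomm_def by (auto intro: rtrancl_into_rtrancl)
  then have "internal_direct_sum W A (S - A)"
    by (intro commuting_parts_direct_sum) (auto simp: A_def)
  moreover have "x \<in> A" "y \<in> S - A" using xy no by (auto simp: A_def)
  ultimately show False
    using irr[unfolded coxeter_irreducible_def]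
    by (elim notE, intro exI[of _ A] exI[of _ "S - A"]) (auto simp: A_def)
qed

section \<open>Conjugates of generic elements\<close>

text \<open>For these \<open>g\<close> the product \<open>t g t\<close> is longer than \<open>g\<close> by two, and \<open>t\<close> is a descent of it on both
  sides.\<close>

definition generic :: "'a \<Rightarrow> 'a set" where
  "generic t = {g \<in> carrier W. t \<notin> N g \<and> t \<notin> N (inv g) \<and> t \<otimes> g \<noteq> g \<otimes> t}"

definition conj_by :: "'a \<Rightarrow> 'a \<Rightarrow> 'a" where
  "conj_by v g = v \<otimes> g \<otimes> inv v"

abbreviation chain :: "'a list \<Rightarrow> bool" where
  "chain \<equiv> successively (\<lambda>x y. x \<otimes> y \<noteq> y \<otimes> x)"

text \<open>If consecutive letters do not commute, no letter of \<open>v\<close> can be moved past its successor, so the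
  first letter is the only candidate for a descent coming from \<open>v\<close>. Formally, descents of
  non-commuting letters exclude each other.\<close>

lemma chain_descent:
  assumes "chain v" "v \<in> lists S" "v \<noteq> []" "z \<in> carrier W" "last v \<notin> N z"
  shows "hd v \<in> N (wval v \<otimes> z)"
  using assms
proof (induction v)
  case (Cons x v)
  then have x: "x \<in> S" "x \<in> carrier W" "wval v \<in> carrier W" by (auto intro: S_carrier wval_closed)
  have "x \<notin> N (wval v \<otimes> z)"
  proof (cases "v = []")
    case False
    then have "hd v \<in> N (wval v \<otimes> z)" using Cons by (auto simp: successively_Cons)
    moreover have "hd v \<in> S" "x \<otimes> hd v \<noteq> hd v \<otimes> x" using False Cons.prems by (auto simp: successively_Cons)
    ultimately show ?thesis using desc_exclusive[of x "hd v" "wval v \<otimes> z"] x Cons.prems by auto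
  qed (use Cons x in auto)
  then show ?case using x Cons.prems desc_flip[of x "wval v \<otimes> z"] by (simp add: m_assoc)
qed simp

text \<open>Lengthening \<open>g\<close> on the right by the inverse of a chain creates no left descent \<open>t\<close>. By
  \<open>desc_right\<close> such a descent could arise only from an equation \<open>t q = q y\<close>; passing to inverses, the
  two letters \<open>y\<close> and \<open>x\<close> at the start of the chain would be descents of one element, although
  they do not commute.\<close>

lemma generic_right:
  assumes g: "g \<in> generic t" and v: "chain v" "v \<in> lists S" "v \<noteq> []" "last v = t"
  shows "t \<notin> N (g \<otimes> inv (wval v))"
  using v
proof (induction v)
  case (Cons y v)
  have gc: "g \<in> carrier W" "t \<notin> N g" "t \<notin> N (inv g)" "t \<otimes> g \<noteq> g \<otimes> t" using g by (auto simp: generic_def)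
  have t: "t \<in> S" using Cons.prems by (metis in_listsD last_in_set)
  have y: "y \<in> S" "y \<in> carrier W" and v: "v \<in> lists S" "wval v \<in> carrier W"
    using Cons.prems by (auto intro: S_carrier wval_closed)
  define q where "q = g \<otimes> inv (wval v)"
  have q: "q \<in> carrier W" "g \<otimes> inv (wval (y # v)) = q \<otimes> y"
    using gc y v by (simp_all add: q_def inv_mult_group m_assoc)
  have tq: "t \<notin> N q" using gc Cons by (cases "v = []") (auto simp: q_def successively_Cons)
  have "t \<otimes> q \<noteq> q \<otimes> y"
  proof (cases "v = []")
    case True
    then show ?thesis using gc Cons.prems by (simp add: q_def)
  next
    case False
    define x where "x = hd v"
    have x: "x \<in> S" "y \<otimes> x \<noteq> x \<otimes> y" using False v Cons.prems by (auto simp: x_def successively_Cons)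
    have iq: "inv q = wval v \<otimes> inv g" using gc v by (simp add: q_def inv_mult_group)
    have xq: "x \<in> N (inv q)"
      unfolding iq x_def using Cons.prems False v gc by (intro chain_descent) (auto simp: successively_Cons)
    show ?thesis
    proof
      assume eq: "t \<otimes> q = q \<otimes> y"
      have "inv (q \<otimes> y) = y \<otimes> inv q" using q y by (simp add: inv_mult_group)
      moreover have "inv (t \<otimes> q) = inv q \<otimes> t" using q t S_carrier by (simp add: inv_mult_group)
      ultimately have eq': "y \<otimes> inv q = inv q \<otimes> t" using eq by simp
      have yq: "y \<notin> N (inv q)" using desc_exclusive[of y x "inv q"] x xq y q by auto
      have "y \<in> N (inv q \<otimes> t)" using yq desc_flip[of y "inv q"] y q by (simp flip: eq')
      moreover have "x \<otimes> inv q \<noteq> inv q \<otimes> t"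
        using x y q S_carrier by (metis eq' inv_closed right_cancel)
      then have "x \<in> N (inv q \<otimes> t)" using desc_right[of x t "inv q"] x t q xq by simp
      ultimately show False using desc_exclusive[of y x "inv q \<otimes> t"] x y q t S_carrier by auto
    qed
  qed
  then show ?case using desc_right[of t y q] tq q t y by simp
qed simp

lemma conj_generic_descent:
  assumes g: "g \<in> generic t" and v: "chain (p @ q)" "p @ q \<in> lists S" "q \<noteq> []" "last q = t"
  shows "hd q \<in> N (inv (wval p) \<otimes> conj_by (wval (p @ q)) g)"
proof -
  have c: "g \<in> carrier W" "wval p \<in> carrier W" "wval q \<in> carrier W" "p \<in> lists S" "q \<in> lists S"
    using g v by (auto simp: generic_def intro: wval_closed)
  have "inv (wval p) \<otimes> conj_by (wval (p @ q)) g = wval q \<otimes> (g \<otimes> inv (wval (p @ q)))"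
    using c by (simp add: conj_by_def wval_append m_assoc flip: m_assoc[of "inv (wval p)"])
  moreover have "t \<notin> N (g \<otimes> inv (wval (p @ q)))"
    using v g by (intro generic_right) auto
  then have "hd q \<in> N (wval q \<otimes> (g \<otimes> inv (wval (p @ q))))"
    using v c by (intro chain_descent) (auto simp: successively_append_iff wval_append)
  ultimately show ?thesis by simp
qed

text \<open>Walk to and fro \<open>n\<close> times between \<open>b\<close> and \<open>a\<close>, then leave through \<open>c\<close>, return to \<open>b\<close> and follow
  the path \<open>q\<close>. Walks with different \<open>n\<close> part after a common prefix ending in \<open>b\<close>, one going on with
  \<open>c, b\<close>, the other with \<open>a\<close>.\<close>

fun walk :: "'a \<Rightarrow> 'a \<Rightarrow> 'a \<Rightarrow> 'a list \<Rightarrow> nat \<Rightarrow> 'a list" where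
  "walk a b c q 0 = b # c # q"
| "walk a b c q (Suc n) = b # a # walk a b c q n"

lemma walk_props:
  assumes "a \<in> S" "b \<in> S" "c \<in> S" "b \<otimes> a \<noteq> a \<otimes> b" "b \<otimes> c \<noteq> c \<otimes> b"
    and "chain q" "q \<in> lists S" "q \<noteq> []" "hd q = b"
  shows "chain (walk a b c q n)" "walk a b c q n \<in> lists S" "hd (walk a b c q n) = b"
    "last (walk a b c q n) = last q" "walk a b c q n \<noteq> []"
proof -
  have "chain (walk a b c q n) \<and> walk a b c q n \<in> lists S \<and> hd (walk a b c q n) = b \<and>
    last (walk a b c q n) = last q \<and> walk a b c q n \<noteq> []"
    using assms by (induction n) (auto simp: successively_Cons)
  then show "chain (walk a b c q n)" "walk a b c q n \<in> lists S" "hd (walk a b c q n) = b"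
    "last (walk a b c q n) = last q" "walk a b c q n \<noteq> []" by auto
qed

lemma walk_split: "\<exists>p. \<forall>d. walk a b c q (i + d) = p @ walk a b c q d"
proof (induction i)
  case 0
  show ?case by (intro exI[of _ "[]"]) simp
next
  case (Suc i)
  then obtain p where "\<forall>d. walk a b c q (i + d) = p @ walk a b c q d" by blast
  then show ?case by (intro exI[of _ "b # a # p"]) simp
qed

text \<open>After removal of the common prefix, a common element would have both \<open>c\<close> and \<open>a\<close> as
  descents. If these do not commute, this is impossible. Otherwise \<open>a\<close> is still a descent after \<open>c\<close>
  is stripped off, and so is \<open>b\<close>, the letter that follows \<open>c\<close> in the first walk; but \<open>a\<close> and \<open>b\<close>
  do not commute.\<close>

lemma walks_disjoint:
  assumes abc: "a \<in> S" "b \<in> S" "c \<in> S" "b \<otimes> a \<noteq> a \<otimes> b" "b \<otimes> c \<noteq> c \<otimes> b" "a \<noteq> c"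
    and q: "chain q" "q \<in> lists S" "q \<noteq> []" "hd q = b" "last q = t" and "i < j"
  shows "conj_by (wval (walk a b c q i)) ` generic t \<inter> conj_by (wval (walk a b c q j)) ` generic t = {}"
proof (rule ccontr)
  assume "\<not> ?thesis"
  then obtain h g g' where g: "g \<in> generic t" "h = conj_by (wval (walk a b c q i)) g"
    and g': "g' \<in> generic t" "h = conj_by (wval (walk a b c q j)) g'" by blast
  obtain p where p: "\<And>d. walk a b c q (i + d) = p @ walk a b c q d" using walk_split by blast
  obtain d where d: "j = i + Suc d" using \<open>i < j\<close> less_iff_Suc_add by auto
  have wi: "walk a b c q i = (p @ [b]) @ (c # q)" "walk a b c q i = (p @ [b, c]) @ q" using p[of 0] by simp_all
  have wj: "walk a b c q j = (p @ [b]) @ (a # walk a b c q d)" using p[of "Suc d"] d by simp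
  note props = walk_props[OF abc(1-5) q(1-4)]
  have pS: "p @ [b] \<in> lists S" using props(2)[of i] wi by simp
  define z where "z = inv (wval (p @ [b])) \<otimes> h"
  have hc: "h \<in> carrier W"
    using g props(2)[of i] wval_closed by (simp add: conj_by_def generic_def)
  have zc: "z \<in> carrier W" using hc pS by (simp add: z_def del: append_assoc wval_simps)
  have cz: "c \<in> N z"
    using conj_generic_descent[of g t "p @ [b]" "c # q"] g q props(1,2)[of i] unfolding wi(1) z_def by auto
  have bz: "b \<in> N (c \<otimes> z)"
  proof -
    have "wval (p @ [b, c]) = wval (p @ [b]) \<otimes> c"
      using wval_append[of "p @ [b]" "[c]"] pS abc S_carrier by simp
    then have "inv (wval (p @ [b, c])) \<otimes> h = c \<otimes> z"
      using pS abc S_carrier hc unfolding z_def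
      by (simp add: inv_mult_group m_assoc del: append_assoc wval_simps)
    moreover have "b \<in> N (inv (wval (p @ [b, c])) \<otimes> h)"
      using conj_generic_descent[of g t "p @ [b, c]" q] g q props(1,2)[of i] unfolding wi(2) by auto
    ultimately show ?thesis by simp
  qed
  have az: "a \<in> N z"
    using conj_generic_descent[of g' t "p @ [b]" "a # walk a b c q d"] g' q(5) props(4)[of d] props(5)[of d]
      props(1,2)[of j] unfolding wj z_def by auto
  have ac: "a \<otimes> c = c \<otimes> a" using desc_exclusive[of a c z] abc az cz zc by blast
  then have "a \<in> N (c \<otimes> z)" using desc_commute[of a c z] abc az zc by blast
  then show False using desc_exclusive[of b a "c \<otimes> z"] bz abc zc S_carrier by auto
qed

lemma chain_between:
  assumes "(x, y) \<in> noncomm\<^sup>*" "x \<in> S"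
  shows "\<exists>q. chain q \<and> q \<in> lists S \<and> q \<noteq> [] \<and> hd q = x \<and> last q = y"
  using assms
proof (induction rule: converse_rtrancl_induct)
  case base
  then show ?case by (intro exI[of _ "[y]"]) auto
next
  case (step u v)
  then obtain q where "chain q" "q \<in> lists S" "q \<noteq> []" "hd q = v" "last q = y"
    by (auto simp: noncomm_def)
  then show ?case using step by (intro exI[of _ "u # q"]) (auto simp: successively_Cons noncomm_def)
qed

text \<open>If \<open>t\<close> is not a descent of \<open>g\<close> on either side, it commutes with \<open>g\<close> (as
  \<open>g\<close> is not generic), and hence with every descent of
  \<open>g\<close>. So the generators that are descents commute with those that are not. As the
  graph is connected and \<open>g \<noteq> \<one>\<close> has a descent, all generators are descents.\<close>

lemma nongeneric_descents:
  assumes conn: "\<And>x y. x \<in> S \<Longrightarrow> y \<in> S \<Longrightarrow> (x, y) \<in> noncomm\<^sup>*"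
    and g: "g \<in> carrier W" "g \<noteq> \<one>" and ng: "\<And>t. t \<in> S \<Longrightarrow> g \<notin> generic t"
    and t: "t \<in> S"
  shows "t \<in> N g \<or> t \<in> N (inv g)"
proof (rule ccontr)
  assume tn: "\<not> ?thesis"
  define A where "A = {t \<in> S. t \<notin> N g \<and> t \<notin> N (inv g)}"
  have one_side: "x \<otimes> t = t \<otimes> x"
    if "t \<in> S" "x \<in> S" "h \<in> carrier W" "t \<otimes> h = h \<otimes> t" "x \<in> N h" "t \<notin> N h" for x t h
  proof (rule ccontr)
    assume nc: "x \<otimes> t \<noteq> t \<otimes> x"
    have "x \<otimes> h \<noteq> h \<otimes> t" using that nc S_carrier by (metis right_cancel)
    then have "x \<in> N (t \<otimes> h)" using desc_right[of x t h] that by simp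
    moreover have "t \<in> N (t \<otimes> h)" using desc_flip[of t h] that(1,3,6) by blast
    ultimately show False using desc_exclusive[of x t "t \<otimes> h"] nc that S_carrier by auto
  qed
  have edge: "y \<in> A" if "(x, y) \<in> noncomm" "x \<in> A" for x y
  proof (rule ccontr)
    assume "y \<notin> A"
    then have y: "y \<in> N g \<or> y \<in> N (inv g)" "y \<in> S" using that by (auto simp: A_def noncomm_def)
    have x: "x \<in> S" "x \<notin> N g" "x \<notin> N (inv g)" using that by (auto simp: A_def)
    then have xg: "x \<otimes> g = g \<otimes> x" using ng g by (auto simp: generic_def)
    have "inv (x \<otimes> g) = inv (g \<otimes> x)" by (simp only: xg)
    then have xg': "x \<otimes> inv g = inv g \<otimes> x" using x g S_carrier by (simp add: inv_mult_group)
    have "y \<otimes> x = x \<otimes> y"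
      using y one_side[of x y g] one_side[of x y "inv g"] x g xg xg' by auto
    then show False using that by (simp add: noncomm_def)
  qed
  have "y \<in> A" if "y \<in> S" for y
    using conn[OF t that]
  proof (induction rule: rtrancl_induct)
    case base
    then show ?case using t tn by (simp add: A_def)
  qed (use edge in blast)
  then show False using exists_descent[OF g] by (auto simp: A_def)
qed

text \<open>If \<open>g\<close> and all \<open>s g s\<close> are not generic, every generator is a descent of each of them on one side.
  Let \<open>b\<close> be a left descent of \<open>h = g\<close> (or of the inverse). Its neighbours \<open>a\<close> and \<open>c\<close> are then right
  descents and commute. Conjugation by \<open>a\<close> moves \<open>a\<close> to the left, which forces \<open>b\<close> to the right and so
  \<open>c\<close> to the left; but \<open>c\<close> is not affected by conjugation with \<open>a\<close>.\<close>

lemma exists_generic_conjugate: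
  assumes conn: "\<And>x y. x \<in> S \<Longrightarrow> y \<in> S \<Longrightarrow> (x, y) \<in> noncomm\<^sup>*"
    and abc: "a \<in> S" "b \<in> S" "c \<in> S" "b \<otimes> a \<noteq> a \<otimes> b" "b \<otimes> c \<noteq> c \<otimes> b" "a \<noteq> c"
    and g: "g \<in> carrier W" "g \<noteq> \<one>"
  shows "\<exists>t\<in>S. g \<in> generic t \<or> (\<exists>s\<in>S. s \<otimes> g \<otimes> s \<in> generic t)"
proof (rule ccontr)
  assume not: "\<not> ?thesis"
  have main: False if h: "h \<in> carrier W" "h \<noteq> \<one>" and bh: "b \<in> N h"
    and dh: "\<And>t. t \<in> S \<Longrightarrow> t \<in> N h \<or> t \<in> N (inv h)"
    and dc: "\<And>s t. s \<in> S \<Longrightarrow> t \<in> S \<Longrightarrow> t \<in> N (s \<otimes> h \<otimes> s) \<or> t \<in> N (inv (s \<otimes> h \<otimes> s))" for h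
  proof -
    have car: "a \<in> carrier W" "b \<in> carrier W" "c \<in> carrier W" using abc S_carrier by auto
    have n: "a \<notin> N h" "c \<notin> N h" using desc_exclusive[of b a h] desc_exclusive[of b c h] abc bh h by auto
    have i: "a \<in> N (inv h)" "c \<in> N (inv h)" using dh n abc by auto
    have ac: "a \<otimes> c = c \<otimes> a" using desc_exclusive[of a c "inv h"] i abc h by auto
    have xh: "x \<otimes> h \<noteq> h \<otimes> a" if "x \<in> S" "x \<notin> N h" for x
    proof
      assume eq: "x \<otimes> h = h \<otimes> a"
      then have "h \<otimes> a \<otimes> inv h = x" using h car that S_carrier by (simp flip: eq add: m_assoc)
      then show False using N_inv[of h a] i car h that by simp
    qed
    have inv_h': "inv (a \<otimes> h \<otimes> a) = a \<otimes> (inv h \<otimes> a)"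
      using abc car h by (simp add: inv_mult_group m_assoc)
    have "a \<otimes> inv h \<noteq> inv h \<otimes> a"
    proof
      assume "a \<otimes> inv h = inv h \<otimes> a"
      then have "inv (a \<otimes> inv h) = inv (inv h \<otimes> a)" by simp
      then show False using xh[of a] n abc car h by (simp add: inv_mult_group)
    qed
    then have "a \<in> N (inv h \<otimes> a)" using desc_right[of a a "inv h"] i abc h by simp
    then have "a \<notin> N (inv (a \<otimes> h \<otimes> a))" unfolding inv_h' using desc_flip[of a "inv h \<otimes> a"] abc car h by simp
    then have a': "a \<in> N (a \<otimes> h \<otimes> a)" using dc abc by blast
    then have "b \<notin> N (a \<otimes> h \<otimes> a)" using desc_exclusive[of b a "a \<otimes> h \<otimes> a"] abc car h by auto
    then have "b \<in> N (inv (a \<otimes> h \<otimes> a))" using dc abc by blast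
    then have "c \<notin> N (inv (a \<otimes> h \<otimes> a))" using desc_exclusive[of b c "inv (a \<otimes> h \<otimes> a)"] abc car h by auto
    then have "c \<in> N (a \<otimes> h \<otimes> a)" using dc abc by blast
    then have "c \<in> N (h \<otimes> a)" using desc_commute[of c a "h \<otimes> a"] ac abc car h by (simp add: m_assoc)
    then show False using desc_right[of c a h] n xh[of c] abc h by simp
  qed
  have ne: "s \<otimes> g \<otimes> s \<noteq> \<one>" "s \<otimes> g \<otimes> s \<in> carrier W" if "s \<in> S" for s
  proof -
    show c: "s \<otimes> g \<otimes> s \<in> carrier W" using that g S_carrier by simp
    show "s \<otimes> g \<otimes> s \<noteq> \<one>"
      using S_conj_conj[of s g] that g S_carrier S_square by (metis r_one)
  qed
  have d: "t \<in> N g \<or> t \<in> N (inv g)" if "t \<in> S" for t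
    using nongeneric_descents[OF conn g _ that] not by blast
  have dc: "t \<in> N (s \<otimes> g \<otimes> s) \<or> t \<in> N (inv (s \<otimes> g \<otimes> s))" if "s \<in> S" "t \<in> S" for s t
    using nongeneric_descents[OF conn ne(2)[OF that(1)] ne(1)[OF that(1)] _ that(2)] not that by blast
  have inv_conj: "inv (s \<otimes> g \<otimes> s) = s \<otimes> inv g \<otimes> s" if "s \<in> S" for s
    using that g S_carrier by (simp add: inv_mult_group m_assoc)
  show False
  proof (cases "b \<in> N g")
    case True
    then show ?thesis using main[of g] g d dc by blast
  next
    case False
    then have "b \<in> N (inv g)" using d abc by blast
    moreover have "t \<in> N (s \<otimes> inv g \<otimes> s) \<or> t \<in> N (inv (s \<otimes> inv g \<otimes> s))" if "s \<in> S" "t \<in> S" for s t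
      using dc[OF that] inv_conj[OF that(1)] ne(2)[OF that(1)] by (metis inv_inv)
    moreover have "inv g \<noteq> \<one>" using g by (metis inv_inv inv_one)
    ultimately show ?thesis using main[of "inv g"] g d by (metis inv_closed inv_inv)
  qed
qed

text \<open>A connected graph in which no vertex has two neighbours has at most two vertices.\<close>

lemma branching_vertex:
  assumes conn: "\<And>x y. x \<in> S \<Longrightarrow> y \<in> S \<Longrightarrow> (x, y) \<in> noncomm\<^sup>*"
    and "finite S" "card S \<ge> 3"
  obtains a b c where "a \<in> S" "b \<in> S" "c \<in> S" "b \<otimes> a \<noteq> a \<otimes> b" "b \<otimes> c \<noteq> c \<otimes> b" "a \<noteq> c"
proof (rule ccontr)
  assume "\<not> thesis"
  then have key: False if "a \<in> S" "b \<in> S" "c \<in> S" "b \<otimes> a \<noteq> a \<otimes> b" "b \<otimes> c \<noteq> c \<otimes> b" "a \<noteq> c" for a b c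
    using that \<open>\<And>c b a. \<lbrakk>a \<in> S; b \<in> S; c \<in> S; b \<otimes> a \<noteq> a \<otimes> b; b \<otimes> c \<noteq> c \<otimes> b; a \<noteq> c\<rbrakk> \<Longrightarrow> thesis\<close>[of a b c] by simp
  have uniq: "y = z" if "(x, y) \<in> noncomm" "(x, z) \<in> noncomm" for x y z
    using that key[of y x z] unfolding noncomm_def by fastforce
  have symm: "(y, x) \<in> noncomm" if "(x, y) \<in> noncomm" for x y using that by (auto simp: noncomm_def)
  obtain x where x: "x \<in> S" using assms by fastforce
  have "\<not> S \<subseteq> {x}" using card_mono[of "{x}" S] assms by auto
  then obtain y where y: "y \<in> S" "y \<noteq> x" by blast
  obtain z where z: "(x, z) \<in> noncomm" using conn[OF x y(1)] y(2) by (auto elim: converse_rtranclE)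
  have "u \<in> {x, z}" if "u \<in> S" for u
    using conn[OF x that]
  proof (induction rule: rtrancl_induct)
    case (step u v)
    then show ?case using uniq[of x z v] uniq[OF symm[OF z], of v] z by auto
  qed simp
  then have "card S \<le> card {x, z}" by (intro card_mono) auto
  also have "\<dots> \<le> 2" by (simp add: card_insert_if)
  finally show False using assms by simp
qed

section \<open>The spectral gap of conjugation\<close>

text \<open>The function is the density of a finite measure on \<open>W\<close>. The error term is the pointwise one
  that the deformed representation produces; summation bounds it by \<open>3 \<epsilon>\<close> times the total mass. The
  inequality in one direction suffices because conjugation by \<open>s\<close> is an involution.\<close>

definition almost_invariant :: "real \<Rightarrow> ('a \<Rightarrow> real) \<Rightarrow> bool" where
  "almost_invariant \<epsilon> f \<longleftrightarrow> (\<forall>w\<in>carrier W. 0 \<le> f w) \<and> f summable_on carrier W \<and>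
     (\<forall>s\<in>S. \<forall>w\<in>carrier W. f w \<le> f (s \<otimes> w \<otimes> s) + \<epsilon> * (f (s \<otimes> w) + f (s \<otimes> w \<otimes> s) + f w))"

lemma conj_by_closed [simp]: "v \<in> carrier W \<Longrightarrow> g \<in> carrier W \<Longrightarrow> conj_by v g \<in> carrier W"
  by (simp add: conj_by_def)

lemma conj_by_mult:
  "v \<in> carrier W \<Longrightarrow> w \<in> carrier W \<Longrightarrow> g \<in> carrier W \<Longrightarrow> conj_by (v \<otimes> w) g = conj_by v (conj_by w g)"
  by (simp add: conj_by_def inv_mult_group m_assoc)

lemma inj_conj_by: "v \<in> carrier W \<Longrightarrow> A \<subseteq> carrier W \<Longrightarrow> inj_on (conj_by v) A"
  by (rule inj_onI) (simp add: conj_by_def subset_iff)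

lemma mass_mono:
  assumes "almost_invariant \<epsilon> f" "A \<subseteq> B" "B \<subseteq> carrier W"
  shows "infsum f A \<le> infsum f B"
proof (rule infsum_mono2)
  show "f summable_on A" "f summable_on B"
    using assms by (auto simp: almost_invariant_def intro: summable_on_subset)
qed (use assms in \<open>auto simp: almost_invariant_def\<close>)

lemma mass_translate:
  assumes f: "almost_invariant \<epsilon> f" and h: "inj_on h A" "h ` A \<subseteq> carrier W"
  shows "(\<lambda>w. f (h w)) summable_on A" "infsum (\<lambda>w. f (h w)) A \<le> infsum f (carrier W)"
proof -
  have "f summable_on h ` A"
    using f h(2) by (auto simp: almost_invariant_def intro: summable_on_subset)
  then show "(\<lambda>w. f (h w)) summable_on A"
    using summable_on_reindex[OF h(1), of f] by (simp add: o_def)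
  show "infsum (\<lambda>w. f (h w)) A \<le> infsum f (carrier W)"
    using infsum_reindex[OF h(1), of f] mass_mono[OF f h(2)] by (simp add: o_def)
qed

lemma mass_conj_gen:
  assumes f: "almost_invariant \<epsilon> f" and "\<epsilon> \<ge> 0" and s: "s \<in> S" and A: "A \<subseteq> carrier W"
  shows "infsum f A \<le> infsum f (conj_by s ` A) + 3 * \<epsilon> * infsum f (carrier W)"
proof -
  let ?M = "infsum f (carrier W)"
  have c: "s \<in> carrier W" using s S_carrier by simp
  have conj_s: "s \<otimes> w \<otimes> s = conj_by s w" for w using s by (simp add: conj_by_def)
  have i1: "inj_on (\<lambda>w. s \<otimes> w) A" using A c S_cancel[OF s] by (intro inj_onI) (metis subsetD)
  have i2: "inj_on (\<lambda>w. w) A" by simp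
  note t1 = mass_translate[OF f i1] and t2 = mass_translate[OF f i2] and t3 = mass_translate[OF f inj_conj_by[OF c A]]
  have sub: "(\<lambda>w. s \<otimes> w) ` A \<subseteq> carrier W" "(\<lambda>w. w) ` A \<subseteq> carrier W" "conj_by s ` A \<subseteq> carrier W"
    using A c by auto
  note sm = t1(1)[OF sub(1)] t2(1)[OF sub(2)] t3(1)[OF sub(3)]
  have "infsum f A \<le> infsum (\<lambda>w. f (conj_by s w) + \<epsilon> * (f (s \<otimes> w) + f (conj_by s w) + f w)) A"
  proof (intro infsum_mono summable_on_add summable_on_cmult_right sm)
    fix w assume "w \<in> A"
    then show "f w \<le> f (conj_by s w) + \<epsilon> * (f (s \<otimes> w) + f (conj_by s w) + f w)"
      using f s A unfolding almost_invariant_def conj_s[symmetric] by blast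
  qed
  also have "\<dots> = infsum (\<lambda>w. f (conj_by s w)) A + \<epsilon> * (infsum (\<lambda>w. f (s \<otimes> w)) A + infsum (\<lambda>w. f (conj_by s w)) A + infsum f A)"
    using sm by (simp add: infsum_add infsum_cmult_right' summable_on_add summable_on_cmult_right)
  also have "infsum (\<lambda>w. f (conj_by s w)) A = infsum f (conj_by s ` A)"
    using infsum_reindex[OF inj_conj_by[OF c A], of f] by (simp add: o_def)
  also have "\<epsilon> * (infsum (\<lambda>w. f (s \<otimes> w)) A + infsum f (conj_by s ` A) + infsum f A) \<le> \<epsilon> * (?M + ?M + ?M)"
    using t1(2)[OF sub(1)] mass_mono[OF f sub(3)] mass_mono[OF f A] \<open>\<epsilon> \<ge> 0\<close>
    by (intro mult_left_mono add_mono) auto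
  finally show ?thesis by (simp add: algebra_simps)
qed

lemma mass_conj_word:
  assumes f: "almost_invariant \<epsilon> f" and "\<epsilon> \<ge> 0" and "xs \<in> lists S" and A: "A \<subseteq> carrier W"
  shows "infsum f A \<le> infsum f (conj_by (wval xs) ` A) + 3 * \<epsilon> * length xs * infsum f (carrier W)"
  using assms(3)
proof induction
  case Nil
  have "conj_by \<one> ` A = A" using A by (auto simp: conj_by_def subset_iff image_iff)
  then show ?case by simp
next
  case (Cons x xs)
  have c: "x \<in> carrier W" "wval xs \<in> carrier W" using Cons S_carrier by auto
  have "conj_by (wval (x # xs)) ` A = conj_by x ` conj_by (wval xs) ` A"
    unfolding image_image using A c by (intro image_cong) (auto simp: conj_by_mult)
  moreover have "conj_by (wval xs) ` A \<subseteq> carrier W" using A c by auto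
  ultimately show ?case
    using Cons.IH mass_conj_gen[OF f \<open>\<epsilon> \<ge> 0\<close> Cons.hyps(1), of "conj_by (wval xs) ` A"]
    by (simp add: algebra_simps)
qed

lemma mass_Union_le:
  assumes f: "almost_invariant \<epsilon> f" and I: "finite I" and B: "\<And>i. i \<in> I \<Longrightarrow> B i \<subseteq> carrier W"
  shows "infsum f (\<Union>i\<in>I. B i) \<le> (\<Sum>i\<in>I. infsum f (B i))"
  using I B
proof (induction I)
  case (insert i I)
  have sum: "f summable_on A" if "A \<subseteq> carrier W" for A
    using f that by (auto simp: almost_invariant_def intro: summable_on_subset)
  have U: "(\<Union>i\<in>I. B i) \<subseteq> carrier W" using insert by auto
  let ?D = "(\<Union>i\<in>I. B i) - B i"
  have "infsum f (B i \<union> ?D) = infsum f (B i) + infsum f ?D"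
    using insert U by (intro infsum_Un_disjoint sum) auto
  moreover have "infsum f ?D \<le> infsum f (\<Union>i\<in>I. B i)" using U by (intro mass_mono[OF f]) auto
  moreover have "(\<Union>i\<in>insert i I. B i) = B i \<union> ?D" by auto
  ultimately show ?case using insert by simp
qed simp

text \<open>With \<open>K\<close> disjoint conjugates, each set of generic elements has mass about \<open>M / K\<close>, where \<open>M\<close> is the
  total mass. The complement of \<open>\<one>\<close> is covered by \<open>n (n + 1)\<close> such sets or their conjugates by a
  generator, \<open>n = \<bar>S\<bar>\<close>. For \<open>K = 4 n (n + 1)\<close> they contribute a quarter of \<open>M\<close>, and \<open>\<epsilon>\<close> is
  chosen such that all errors together contribute at most another quarter.\<close>

lemma spectral_gap:
  assumes irr: "coxeter_irreducible W S" and fin: "finite S" and card: "card S \<ge> 3"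
  obtains \<epsilon> where "\<epsilon> > 0"
    "\<And>f w. almost_invariant \<epsilon> f \<Longrightarrow> f \<one> = 0 \<Longrightarrow> w \<in> carrier W \<Longrightarrow> f w = 0"
proof -
  note conn = noncomm_connected[OF irr]
  obtain a b c where abc: "a \<in> S" "b \<in> S" "c \<in> S" "b \<otimes> a \<noteq> a \<otimes> b" "b \<otimes> c \<noteq> c \<otimes> b" "a \<noteq> c"
    using branching_vertex[OF conn fin card] by blast
  have "\<exists>v. \<forall>i j :: nat. v i \<in> lists S \<and>
      (i < j \<longrightarrow> conj_by (wval (v i)) ` generic t \<inter> conj_by (wval (v j)) ` generic t = {})" if t: "t \<in> S" for t
  proof -
    obtain q where q: "chain q" "q \<in> lists S" "q \<noteq> []" "hd q = b" "last q = t"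
      using chain_between[OF conn[OF abc(2) t] abc(2)] by blast
    show ?thesis
      using walk_props(2)[OF abc(1-5) q(1-4)] walks_disjoint[OF abc q]
      by (intro exI[of _ "walk a b c q"]) blast
  qed
  then obtain v :: "'a \<Rightarrow> nat \<Rightarrow> 'a list" where v: "\<And>t i. t \<in> S \<Longrightarrow> v t i \<in> lists S"
    and disj: "\<And>t i j. t \<in> S \<Longrightarrow> i < j \<Longrightarrow>
      conj_by (wval (v t i)) ` generic t \<inter> conj_by (wval (v t j)) ` generic t = {}"
    by metis
  define n where "n = card S"
  define K where "K = 4 * n * (n + 1)"
  define L where "L = (\<Sum>t\<in>S. \<Sum>i<K. length (v t i))"
  define \<epsilon> where "\<epsilon> = 1 / (3 * (real L + 4 * real n ^ 2 + 1))"
  have den: "real L + 4 * real n ^ 2 + 1 > 0" by (simp add: add_nonneg_pos)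
  then have \<epsilon>: "\<epsilon> > 0" by (simp add: \<epsilon>_def)
  have n: "n > 0" using card by (simp add: n_def)
  then have K: "K > 0" by (simp add: K_def)
  show thesis
  proof (rule that[OF \<epsilon>])
    fix f w assume f: "almost_invariant \<epsilon> f" and f1: "f \<one> = 0" and w: "w \<in> carrier W"
    define M where "M = infsum f (carrier W)"
    have sum: "f summable_on A" if "A \<subseteq> carrier W" for A
      using f that by (auto simp: almost_invariant_def intro: summable_on_subset)
    have M0: "M \<ge> 0" unfolding M_def using f by (intro infsum_nonneg) (auto simp: almost_invariant_def)
    have gen: "generic t \<subseteq> carrier W" for t by (auto simp: generic_def)
    have small: "K * infsum f (generic t) \<le> M + 3 * \<epsilon> * L * M" if t: "t \<in> S" for t
    proof -
      have sub: "conj_by (wval (v t i)) ` generic t \<subseteq> carrier W" for i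
        using gen[of t] wval_closed[OF v[OF t]] by auto
      have "K * infsum f (generic t) = (\<Sum>i<K. infsum f (generic t))" by simp
      also have "\<dots> \<le> (\<Sum>i<K. infsum f (conj_by (wval (v t i)) ` generic t) + 3 * \<epsilon> * length (v t i) * M)"
        unfolding M_def using \<epsilon> by (intro sum_mono mass_conj_word[OF f] v t gen) auto
      also have "\<dots> = (\<Sum>i<K. infsum f (conj_by (wval (v t i)) ` generic t)) + 3 * \<epsilon> * (\<Sum>i<K. length (v t i)) * M"
        by (simp add: sum.distrib sum_distrib_left sum_distrib_right)
      also have "(\<Sum>i<K. infsum f (conj_by (wval (v t i)) ` generic t)) = infsum f (\<Union>i<K. conj_by (wval (v t i)) ` generic t)"
      proof (intro sum_infsum sum sub)
        fix i j :: nat assume "i \<noteq> j"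
        then show "conj_by (wval (v t i)) ` generic t \<inter> conj_by (wval (v t j)) ` generic t = {}"
          using disj[OF t, of i j] disj[OF t, of j i] by (cases i j rule: linorder_cases) auto
      qed simp
      also have "\<dots> \<le> M" unfolding M_def using sub by (intro mass_mono[OF f]) auto
      also have "3 * \<epsilon> * (\<Sum>i<K. length (v t i)) * M \<le> 3 * \<epsilon> * L * M"
      proof -
        have le: "(\<Sum>i<K. length (v t i)) \<le> L"
          unfolding L_def using t fin by (intro member_le_sum[of t S "\<lambda>t. \<Sum>i<K. length (v t i)"]) auto
        show ?thesis
          using of_nat_mono[OF le, where 'a = real] \<epsilon> M0 by (intro mult_right_mono mult_left_mono) auto
      qed
      finally show ?thesis by simp
    qed
    define p where "p = (M + 3 * \<epsilon> * L * M) / K"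
    have p: "infsum f (generic t) \<le> p" if "t \<in> S" for t
      using small[OF that] K by (simp add: p_def field_simps)
    have p': "infsum f (conj_by s ` generic t) \<le> p + 3 * \<epsilon> * M" if "s \<in> S" "t \<in> S" for s t
    proof -
      have c: "s \<in> carrier W" using that S_carrier by simp
      have "conj_by s ` conj_by s ` generic t = generic t"
        unfolding image_image using gen[of t] c that
        by (auto simp: subset_iff image_iff conj_by_def S_conj_conj)
      moreover have "conj_by s ` generic t \<subseteq> carrier W" using gen[of t] c by auto
      ultimately show ?thesis
        using mass_conj_gen[OF f less_imp_le[OF \<epsilon>] that(1), of "conj_by s ` generic t"] p[OF that(2)]
        by (simp add: M_def)
    qed
    \<comment> \<open>the index \<open>None\<close> stands for the generic elements themselves, \<open>Some s\<close> for their conjugates by \<open>s\<close>\<close>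
    let ?B = "\<lambda>x. case x of (t, None) \<Rightarrow> generic t | (t, Some s) \<Rightarrow> conj_by s ` generic t"
    let ?I = "S \<times> insert None (Some ` S)"
    have cover: "carrier W - {\<one>} \<subseteq> (\<Union>x\<in>?I. ?B x)"
    proof
      fix g assume g: "g \<in> carrier W - {\<one>}"
      then obtain t where t: "t \<in> S" "g \<in> generic t \<or> (\<exists>s\<in>S. s \<otimes> g \<otimes> s \<in> generic t)"
        using exists_generic_conjugate[OF conn abc, of g] by auto
      from t(2) show "g \<in> (\<Union>x\<in>?I. ?B x)"
      proof
        assume "g \<in> generic t"
        then show ?thesis using t(1) by (intro UN_I[of "(t, None)"]) auto
      next
        assume "\<exists>s\<in>S. s \<otimes> g \<otimes> s \<in> generic t"
        then obtain s where s: "s \<in> S" "s \<otimes> g \<otimes> s \<in> generic t" by blast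
        then have "g = conj_by s (s \<otimes> g \<otimes> s)" using g S_conj_conj by (simp add: conj_by_def)
        then have "g \<in> conj_by s ` generic t" using s by blast
        then show ?thesis using t(1) s by (intro UN_I[of "(t, Some s)"]) auto
      qed
    qed
    have Bsub: "?B x \<subseteq> carrier W" if "x \<in> ?I" for x
      using that gen S_carrier by (auto simp: subset_iff)
    have "infsum f (carrier W) = infsum f (carrier W - {\<one>})"
      using f1 by (intro infsum_cong_neutral) auto
    also have "\<dots> \<le> infsum f (\<Union>x\<in>?I. ?B x)" using cover Bsub by (intro mass_mono[OF f]) auto
    also have "\<dots> \<le> (\<Sum>x\<in>?I. infsum f (?B x))" using fin Bsub by (intro mass_Union_le[OF f]) auto
    also have "\<dots> = (\<Sum>t\<in>S. \<Sum>y\<in>insert None (Some ` S). infsum f (?B (t, y)))"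
      by (simp add: sum.cartesian_product case_prod_beta)
    also have "\<dots> = (\<Sum>t\<in>S. infsum f (generic t) + (\<Sum>s\<in>S. infsum f (conj_by s ` generic t)))"
      using fin by (simp add: sum.reindex)
    also have "\<dots> \<le> (\<Sum>t\<in>S. p + (\<Sum>s\<in>S. p + 3 * \<epsilon> * M))"
      using p p' by (intro sum_mono add_mono) auto
    also have "\<dots> = n * (n + 1) * p + 3 * \<epsilon> * n ^ 2 * M"
      by (simp add: n_def algebra_simps power2_eq_square)
    also have "n * (n + 1) * p = (M + 3 * \<epsilon> * L * M) / 4"
    proof -
      have "real n * (real n + 1) * p = real K * p / 4" by (simp add: K_def algebra_simps)
      also have "real K * p = M + 3 * \<epsilon> * L * M" using K by (simp add: p_def)
      finally show ?thesis by (simp add: algebra_simps)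
    qed
    finally have "M \<le> (M + 3 * \<epsilon> * L * M) / 4 + 3 * \<epsilon> * n ^ 2 * M" by (simp add: M_def)
    also have "\<dots> = M / 4 + 3 * \<epsilon> * (L + 4 * n ^ 2) * (M / 4)" by (simp add: field_simps)
    also have "\<dots> \<le> M / 4 + 1 * (M / 4)"
    proof -
      have "3 * \<epsilon> * (L + 4 * n ^ 2) \<le> 1" using den by (simp add: \<epsilon>_def field_simps)
      then show ?thesis using M0 by (intro add_mono mult_right_mono) auto
    qed
    finally have "M \<le> 0" using M0 by simp
    then show "f w = 0"
      using nonneg_infsum_le_0D[of f "carrier W" w] f w by (auto simp: M_def almost_invariant_def)
  qed
qed

section \<open>The deformed regular representation\<close>

definition diag_coef :: "('a \<Rightarrow> real) \<Rightarrow> 'a \<Rightarrow> 'a \<Rightarrow> complex" where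
  "diag_coef a s w = complex_of_real (if s \<in> N w then - a s else a s)"

definition off_coef :: "('a \<Rightarrow> real) \<Rightarrow> 'a \<Rightarrow> complex" where
  "off_coef a s = complex_of_real (sqrt (1 - (a s)\<^sup>2))"

text \<open>With \<open>diag_coef\<close> and \<open>off_coef\<close> as diagonal and off-diagonal entries this is the matrix with rows
  \<open>(a, b)\<close>, \<open>(b, -a)\<close> on \<open>{w, s w}\<close>. The value outside the carrier is kept, so that the operator is an
  involution on all functions.\<close>

definition left_op :: "('a \<Rightarrow> real) \<Rightarrow> 'a \<Rightarrow> ('a \<Rightarrow> complex) \<Rightarrow> 'a \<Rightarrow> complex" where
  "left_op a s \<xi> w = (if w \<in> carrier W then diag_coef a s w * \<xi> w + off_coef a s * \<xi> (s \<otimes> w) else \<xi> w)"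

definition right_op :: "('a \<Rightarrow> real) \<Rightarrow> 'a \<Rightarrow> ('a \<Rightarrow> complex) \<Rightarrow> 'a \<Rightarrow> complex" where
  "right_op a s \<xi> w = (if w \<in> carrier W then diag_coef a s (inv w) * \<xi> w + off_coef a s * \<xi> (w \<otimes> s) else \<xi> w)"

definition admissible :: "('a \<Rightarrow> real) \<Rightarrow> bool" where
  "admissible a \<longleftrightarrow> (\<forall>s\<in>S. \<bar>a s\<bar> < 1)"

lemma diag_coef_flip: "s \<in> S \<Longrightarrow> w \<in> carrier W \<Longrightarrow> diag_coef a s (s \<otimes> w) = - diag_coef a s w"
  by (simp add: diag_coef_def desc_flip)

lemma diag_coef_commute:
  "s \<in> S \<Longrightarrow> t \<in> S \<Longrightarrow> s \<otimes> t = t \<otimes> s \<Longrightarrow> s \<noteq> t \<Longrightarrow> w \<in> carrier W \<Longrightarrow> diag_coef a s (t \<otimes> w) = diag_coef a s w"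
  by (simp add: diag_coef_def desc_commute)

lemma coefs_square:
  assumes "admissible a" "s \<in> S"
  shows "diag_coef a s w * diag_coef a s w + off_coef a s * off_coef a s = 1"
proof -
  have "(a s)\<^sup>2 \<le> 1" using assms abs_square_le_1[of "a s"] by (auto simp: admissible_def less_imp_le)
  then have "sqrt (1 - (a s)\<^sup>2) * sqrt (1 - (a s)\<^sup>2) = 1 - (a s)\<^sup>2" by simp
  then have "off_coef a s * off_coef a s = 1 - complex_of_real ((a s)\<^sup>2)"
    unfolding off_coef_def by (metis of_real_1 of_real_diff of_real_mult)
  then show ?thesis by (simp add: diag_coef_def power2_eq_square)
qed

lemma off_coef_nonzero: "admissible a \<Longrightarrow> s \<in> S \<Longrightarrow> off_coef a s \<noteq> 0"
  using abs_square_eq_1[of "a s"] by (auto simp: admissible_def off_coef_def)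

lemma compatible_left_op:
  assumes a: "admissible a"
  shows "compatible (left_op a)"
  unfolding compatible_def
proof (intro conjI ballI impI allI ext)
  fix s \<xi> w assume s: "s \<in> S"
  show "left_op a s (left_op a s \<xi>) w = \<xi> w"
  proof (cases "w \<in> carrier W")
    case True
    then have "left_op a s (left_op a s \<xi>) w = (diag_coef a s w * diag_coef a s w + off_coef a s * off_coef a s) * \<xi> w"
      using s S_carrier[OF s] by (simp add: left_op_def diag_coef_flip algebra_simps)
    then show ?thesis using coefs_square[OF a s] by simp
  qed (simp add: left_op_def)
next
  fix s t \<xi> w assume st: "s \<in> S" "t \<in> S" "m s t = 2"
  then have ne: "s \<noteq> t" using m_diag[of s] by auto
  have comm: "s \<otimes> t = t \<otimes> s" by (rule commute_if_two[OF st])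
  show "left_op a s (left_op a t \<xi>) w = left_op a t (left_op a s \<xi>) w"
  proof (cases "w \<in> carrier W")
    case True
    have c: "s \<in> carrier W" "t \<in> carrier W" using st S_carrier by auto
    have "s \<otimes> (t \<otimes> w) = t \<otimes> (s \<otimes> w)" using comm c True by (simp flip: m_assoc)
    moreover have "diag_coef a s (t \<otimes> w) = diag_coef a s w" "diag_coef a t (s \<otimes> w) = diag_coef a t w"
      using diag_coef_commute st comm ne True by metis+
    ultimately show ?thesis using c True by (simp add: left_op_def algebra_simps)
  qed (simp add: left_op_def)
qed

text \<open>The two operators act on the four elements \<open>w\<close>, \<open>s w\<close>, \<open>w t\<close>, \<open>s w t\<close> by a tensor product, unless
  \<open>s w = w t\<close>. In that case \<open>s = t\<close>, since generators that are conjugate are equal, and both operators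
  are the same matrix on \<open>{w, s w}\<close>.\<close>

lemma left_right_commute:
  assumes s: "s \<in> S" and t: "t \<in> S"
  shows "left_op a s (right_op a t \<xi>) = right_op a t (left_op a s \<xi>)"
proof
  fix w
  show "left_op a s (right_op a t \<xi>) w = right_op a t (left_op a s \<xi>) w"
  proof (cases "w \<in> carrier W")
    case w: True
    have c: "s \<in> carrier W" "t \<in> carrier W" using s t S_carrier by auto
    have inv_sw: "inv (s \<otimes> w) = inv w \<otimes> s" using c w s by (simp add: inv_mult_group)
    have "left_op a s (right_op a t \<xi>) w - right_op a t (left_op a s \<xi>) w =
        (diag_coef a s w - diag_coef a s (w \<otimes> t)) * off_coef a t * \<xi> (w \<otimes> t)
        + (diag_coef a t (inv (s \<otimes> w)) - diag_coef a t (inv w)) * off_coef a s * \<xi> (s \<otimes> w)"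
      using w c by (simp add: left_op_def right_op_def m_assoc algebra_simps)
    also have "\<dots> = 0"
    proof (cases "s \<otimes> w = w \<otimes> t")
      case True
      then have "s = t" using S_conjugate_eq s t w by blast
      have "w \<otimes> s \<otimes> inv w = s" using True \<open>s = t\<close> w c by (metis inv_solve_right m_closed)
      then have "s \<in> N (inv w) \<longleftrightarrow> s \<in> N w" using N_inv[of w s] w c by simp
      then have "diag_coef a s (inv w) = diag_coef a s w" by (simp add: diag_coef_def)
      moreover have "diag_coef a s (w \<otimes> t) = - diag_coef a s w" using diag_coef_flip[OF s w] True by simp
      moreover have "diag_coef a s (inv (s \<otimes> w)) = - diag_coef a s (inv w)"
      proof -
        have "inv w \<otimes> s = s \<otimes> inv w"
          using True \<open>s = t\<close> w c s by (metis inv_mult_group inv_sw S_inv)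
        then show ?thesis using inv_sw diag_coef_flip[of s "inv w"] s w by simp
      qed
      ultimately show ?thesis using True \<open>s = t\<close> by (simp add: algebra_simps)
    next
      case False
      have "t \<otimes> inv w \<noteq> inv w \<otimes> s"
      proof
        assume "t \<otimes> inv w = inv w \<otimes> s"
        then have "inv (t \<otimes> inv w) = inv (inv w \<otimes> s)" by simp
        then show False using False w c s t by (simp add: inv_mult_group)
      qed
      then have "diag_coef a t (inv (s \<otimes> w)) = diag_coef a t (inv w)"
        using desc_right[of t s "inv w"] s t w inv_sw by (simp add: diag_coef_def)
      moreover have "diag_coef a s (w \<otimes> t) = diag_coef a s w"
        using desc_right[of s t w] False s t w by (simp add: diag_coef_def)
      ultimately show ?thesis by simp
    qed
    finally show ?thesis by simp
  qed (simp add: left_op_def right_op_def)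
qed

section \<open>Finitely supported functions\<close>

definition supp :: "('a \<Rightarrow> complex) \<Rightarrow> 'a set" where
  "supp f = {w. f w \<noteq> 0}"

definition finsupp :: "('a \<Rightarrow> complex) \<Rightarrow> bool" where
  "finsupp f \<longleftrightarrow> finite (supp f) \<and> supp f \<subseteq> carrier W"

text \<open>Bilinear rather than sesquilinear, since the deformed operators are real and symmetric. Only the
  first argument has to be finitely supported.\<close>

definition pair :: "('a \<Rightarrow> complex) \<Rightarrow> ('a \<Rightarrow> complex) \<Rightarrow> complex" where
  "pair f \<xi> = (\<Sum>w\<in>supp f. f w * \<xi> w)"

definition delta :: "'a \<Rightarrow> 'a \<Rightarrow> complex" where
  "delta v w = (if w = v then 1 else 0)"

lemma pair_superset: "finite F \<Longrightarrow> supp f \<subseteq> F \<Longrightarrow> pair f \<xi> = (\<Sum>w\<in>F. f w * \<xi> w)"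
  unfolding pair_def by (rule sum.mono_neutral_left) (auto simp: supp_def)

lemma supp_delta [simp]: "supp (delta v) = {v}"
  by (auto simp: supp_def delta_def)

lemma finsupp_delta [simp]: "v \<in> carrier W \<Longrightarrow> finsupp (delta v)"
  by (simp add: finsupp_def)

lemma pair_delta [simp]: "pair (delta v) \<xi> = \<xi> v"
  by (simp add: pair_def) (simp add: delta_def)

lemma supp_combination: "supp (\<lambda>w. \<Sum>i\<in>I. z i * f i w) \<subseteq> (\<Union>i\<in>I. supp (f i))"
proof
  fix w assume "w \<in> supp (\<lambda>w. \<Sum>i\<in>I. z i * f i w)"
  then have "(\<Sum>i\<in>I. z i * f i w) \<noteq> 0" by (simp add: supp_def)
  then have "\<exists>i\<in>I. z i * f i w \<noteq> 0" using sum.neutral[of I "\<lambda>i. z i * f i w"] by metis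
  then show "w \<in> (\<Union>i\<in>I. supp (f i))" by (auto simp: supp_def)
qed

lemma finsupp_combination:
  assumes "finite I" "\<And>i. i \<in> I \<Longrightarrow> finsupp (f i)"
  shows "finsupp (\<lambda>w. \<Sum>i\<in>I. z i * f i w)"
  using assms supp_combination[of z f I] unfolding finsupp_def
  by (meson UN_least finite_UN finite_subset subset_trans)

lemma pair_combination:
  assumes "finite I" "\<And>i. i \<in> I \<Longrightarrow> finsupp (f i)"
  shows "pair (\<lambda>w. \<Sum>i\<in>I. z i * f i w) \<xi> = (\<Sum>i\<in>I. z i * pair (f i) \<xi>)"
proof -
  let ?U = "\<Union>i\<in>I. supp (f i)"
  have U: "finite ?U" using assms by (auto simp: finsupp_def)
  have "pair (\<lambda>w. \<Sum>i\<in>I. z i * f i w) \<xi> = (\<Sum>w\<in>?U. (\<Sum>i\<in>I. z i * f i w) * \<xi> w)"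
    by (rule pair_superset[OF U supp_combination])
  also have "\<dots> = (\<Sum>i\<in>I. z i * (\<Sum>w\<in>?U. f i w * \<xi> w))"
    by (simp add: sum_distrib_left sum_distrib_right mult.assoc) (rule sum.swap)
  also have "\<dots> = (\<Sum>i\<in>I. z i * pair (f i) \<xi>)"
  proof (intro sum.cong HOL.refl)
    fix i assume "i \<in> I"
    then have "pair (f i) \<xi> = (\<Sum>w\<in>?U. f i w * \<xi> w)" by (intro pair_superset U) auto
    then show "z i * (\<Sum>w\<in>?U. f i w * \<xi> w) = z i * pair (f i) \<xi>" by simp
  qed
  finally show ?thesis .
qed

lemma finsupp_left_op:
  assumes s: "s \<in> S" and f: "finsupp f"
  shows "finsupp (left_op a s f)"
proof -
  have "supp (left_op a s f) \<subseteq> supp f \<union> (\<lambda>w. s \<otimes> w) ` supp f"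
  proof
    fix w assume w: "w \<in> supp (left_op a s f)"
    show "w \<in> supp f \<union> (\<lambda>w. s \<otimes> w) ` supp f"
    proof (cases "w \<in> supp f")
      case False
      then have "w \<in> carrier W" "s \<otimes> w \<in> supp f" using w by (auto simp: supp_def left_op_def split: if_splits)
      then have "w = s \<otimes> (s \<otimes> w)" "s \<otimes> w \<in> supp f" using s by auto
      then show ?thesis by blast
    qed simp
  qed
  then show ?thesis using f s S_carrier unfolding finsupp_def
    by (auto intro: finite_subset)
qed

lemma pair_left_op:
  assumes s: "s \<in> S" and f: "finsupp f"
  shows "pair (left_op a s f) \<xi> = pair f (left_op a s \<xi>)"
proof -
  have c: "s \<in> carrier W" using s S_carrier by simp
  define F where "F = supp f \<union> supp (left_op a s f)"
  define U where "U = F \<union> (\<lambda>w. s \<otimes> w) ` F"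
  have F: "finite F" "F \<subseteq> carrier W"
    using f finsupp_left_op[OF s f, of a] by (auto simp: F_def finsupp_def)
  have U: "finite U" "U \<subseteq> carrier W" "supp f \<subseteq> U" "supp (left_op a s f) \<subseteq> U"
    using F c by (auto simp: U_def F_def)
  have closed: "s \<otimes> w \<in> U" if "w \<in> U" for w using that F s unfolding U_def by auto
  have "(\<Sum>w\<in>U. f (s \<otimes> w) * \<xi> w) = (\<Sum>w\<in>U. f w * \<xi> (s \<otimes> w))"
    by (rule sum.reindex_bij_witness[of _ "\<lambda>w. s \<otimes> w" "\<lambda>w. s \<otimes> w"]) (use closed U s in auto)
  then have "(\<Sum>w\<in>U. diag_coef a s w * f w * \<xi> w) + off_coef a s * (\<Sum>w\<in>U. f (s \<otimes> w) * \<xi> w)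
      = (\<Sum>w\<in>U. diag_coef a s w * f w * \<xi> w) + off_coef a s * (\<Sum>w\<in>U. f w * \<xi> (s \<otimes> w))" by simp
  then have "(\<Sum>w\<in>U. (diag_coef a s w * f w + off_coef a s * f (s \<otimes> w)) * \<xi> w) =
      (\<Sum>w\<in>U. f w * (diag_coef a s w * \<xi> w + off_coef a s * \<xi> (s \<otimes> w)))"
    by (simp add: sum_distrib_left algebra_simps sum.distrib)
  moreover have "(\<Sum>w\<in>U. left_op a s f w * \<xi> w) = (\<Sum>w\<in>U. (diag_coef a s w * f w + off_coef a s * f (s \<otimes> w)) * \<xi> w)"
    by (intro sum.cong HOL.refl) (use U in \<open>auto simp: left_op_def\<close>)
  moreover have "(\<Sum>w\<in>U. f w * left_op a s \<xi> w) = (\<Sum>w\<in>U. f w * (diag_coef a s w * \<xi> w + off_coef a s * \<xi> (s \<otimes> w)))"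
    by (intro sum.cong HOL.refl) (use U in \<open>auto simp: left_op_def\<close>)
  ultimately show ?thesis
    using pair_superset[OF U(1,3), of "left_op a s \<xi>"] pair_superset[OF U(1,4), of \<xi>] by simp
qed

lemma finsupp_right_op:
  assumes s: "s \<in> S" and f: "finsupp f"
  shows "finsupp (right_op a s f)"
proof -
  have "supp (right_op a s f) \<subseteq> supp f \<union> (\<lambda>w. w \<otimes> s) ` supp f"
  proof
    fix w assume w: "w \<in> supp (right_op a s f)"
    show "w \<in> supp f \<union> (\<lambda>w. w \<otimes> s) ` supp f"
    proof (cases "w \<in> supp f")
      case False
      then have "w \<in> carrier W" "w \<otimes> s \<in> supp f" using w by (auto simp: supp_def right_op_def split: if_splits)
      then have "w = (w \<otimes> s) \<otimes> s" "w \<otimes> s \<in> supp f" using s by auto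
      then show ?thesis by blast
    qed simp
  qed
  then show ?thesis using f s S_carrier unfolding finsupp_def
    by (auto intro: finite_subset)
qed

lemma pair_right_op:
  assumes s: "s \<in> S" and f: "finsupp f"
  shows "pair (right_op a s f) \<xi> = pair f (right_op a s \<xi>)"
proof -
  have c: "s \<in> carrier W" using s S_carrier by simp
  define F where "F = supp f \<union> supp (right_op a s f)"
  define U where "U = F \<union> (\<lambda>w. w \<otimes> s) ` F"
  have F: "finite F" "F \<subseteq> carrier W"
    using f finsupp_right_op[OF s f, of a] by (auto simp: F_def finsupp_def)
  have U: "finite U" "U \<subseteq> carrier W" "supp f \<subseteq> U" "supp (right_op a s f) \<subseteq> U"
    using F c by (auto simp: U_def F_def)
  have closed: "w \<otimes> s \<in> U" if "w \<in> U" for w using that F s unfolding U_def by auto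
  let ?c = "\<lambda>w. diag_coef a s (inv w)"
  have "(\<Sum>w\<in>U. f (w \<otimes> s) * \<xi> w) = (\<Sum>w\<in>U. f w * \<xi> (w \<otimes> s))"
    by (rule sum.reindex_bij_witness[of _ "\<lambda>w. w \<otimes> s" "\<lambda>w. w \<otimes> s"]) (use closed U s in auto)
  then have "(\<Sum>w\<in>U. ?c w * f w * \<xi> w) + off_coef a s * (\<Sum>w\<in>U. f (w \<otimes> s) * \<xi> w)
      = (\<Sum>w\<in>U. ?c w * f w * \<xi> w) + off_coef a s * (\<Sum>w\<in>U. f w * \<xi> (w \<otimes> s))" by simp
  then have "(\<Sum>w\<in>U. (?c w * f w + off_coef a s * f (w \<otimes> s)) * \<xi> w) =
      (\<Sum>w\<in>U. f w * (?c w * \<xi> w + off_coef a s * \<xi> (w \<otimes> s)))"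
    by (simp add: sum_distrib_left algebra_simps sum.distrib)
  moreover have "(\<Sum>w\<in>U. right_op a s f w * \<xi> w) = (\<Sum>w\<in>U. (?c w * f w + off_coef a s * f (w \<otimes> s)) * \<xi> w)"
    by (intro sum.cong HOL.refl) (use U in \<open>auto simp: right_op_def\<close>)
  moreover have "(\<Sum>w\<in>U. f w * right_op a s \<xi> w) = (\<Sum>w\<in>U. f w * (?c w * \<xi> w + off_coef a s * \<xi> (w \<otimes> s)))"
    by (intro sum.cong HOL.refl) (use U in \<open>auto simp: right_op_def\<close>)
  ultimately show ?thesis
    using pair_superset[OF U(1,3), of "right_op a s \<xi>"] pair_superset[OF U(1,4), of \<xi>] by simp
qed

section \<open>The characters\<close>

text \<open>The orbit of the point mass at \<open>\<one>\<close>. These vectors are finitely supported, so no completion to a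
  Hilbert space is necessary.\<close>

definition kern :: "('a \<Rightarrow> real) \<Rightarrow> 'a \<Rightarrow> 'a \<Rightarrow> complex" where
  "kern a g = act (left_op a) g (delta \<one>)"

definition deformed_trace :: "('a \<Rightarrow> real) \<Rightarrow> 'a \<Rightarrow> complex" where
  "deformed_trace a = (\<lambda>g\<in>carrier W. kern a g \<one>)"

context
  fixes a :: "'a \<Rightarrow> real"
  assumes a: "admissible a"
begin

lemma kern_one: "kern a \<one> = delta \<one>"
  by (simp add: kern_def act_one compatible_left_op a)

lemma kern_step: "s \<in> S \<Longrightarrow> g \<in> carrier W \<Longrightarrow> kern a (s \<otimes> g) = left_op a s (kern a g)"
  by (simp add: kern_def act_step compatible_left_op a)

lemma finsupp_kern: "g \<in> carrier W \<Longrightarrow> finsupp (kern a g)"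
  by (induction rule: W_induct) (auto simp: kern_one kern_step finsupp_left_op)

lemma cnj_kern: "g \<in> carrier W \<Longrightarrow> cnj (kern a g w) = kern a g w"
proof (induction arbitrary: w rule: W_induct)
  case (mult s g)
  then show ?case by (simp add: kern_step left_op_def diag_coef_def off_coef_def)
qed (simp add: kern_one delta_def)

lemma kern_right: "g \<in> carrier W \<Longrightarrow> s \<in> S \<Longrightarrow> kern a (g \<otimes> s) = right_op a s (kern a g)"
proof (induction rule: W_induct)
  case one
  have c: "s \<in> carrier W" using one S_carrier by simp
  have eq: "s \<otimes> w = \<one> \<longleftrightarrow> w \<otimes> s = \<one>" if "w \<in> carrier W" for w
    using that c inv_comm by blast
  have "left_op a s (delta \<one>) w = right_op a s (delta \<one>) w" for w
    using eq[of w] by (cases "w = \<one>") (auto simp: left_op_def right_op_def delta_def diag_coef_def)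
  then show ?case using kern_step[of s \<one>] one c by (auto simp: kern_one)
next
  case (mult t g)
  then show ?case
    using S_carrier by (simp add: m_assoc kern_step left_right_commute)
qed

lemma act_inv_at_one:
  "g \<in> carrier W \<Longrightarrow> act (left_op a) (inv g) \<xi> \<one> = pair (kern a g) \<xi>"
proof (induction arbitrary: \<xi> rule: W_induct)
  case one
  then show ?case by (simp add: kern_one act_one compatible_left_op a)
next
  case (mult s g)
  have "act (left_op a) (inv (s \<otimes> g)) \<xi> = act (left_op a) (inv g) (left_op a s \<xi>)"
    using mult S_carrier by (simp add: inv_mult_group act_mult act_gen compatible_left_op a)
  then show ?case using mult by (simp add: kern_step pair_left_op finsupp_kern)
qed

lemma kern_inv_mult:
  assumes "g \<in> carrier W" "h \<in> carrier W"
  shows "kern a (inv g \<otimes> h) \<one> = pair (kern a g) (kern a h)"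
proof -
  have "kern a (inv g \<otimes> h) = act (left_op a) (inv g) (kern a h)"
    unfolding kern_def by (rule act_mult[OF compatible_left_op[OF a]]) (use assms in auto)
  then show ?thesis using act_inv_at_one[OF assms(1)] by simp
qed

text \<open>At \<open>\<one>\<close> the left and the right operator of a generator have the same coefficients, because \<open>\<one>\<close> has no
  descents; so the trace property for a generator is immediate from \<open>kern_right\<close>.\<close>

lemma kern_trace:
  assumes "g \<in> carrier W" "h \<in> carrier W"
  shows "kern a (g \<otimes> h) \<one> = kern a (h \<otimes> g) \<one>"
  using assms
proof (induction arbitrary: h rule: W_induct)
  case (mult s g)
  have c: "s \<in> carrier W" using mult S_carrier by simp
  have gen: "kern a (s \<otimes> x) \<one> = kern a (x \<otimes> s) \<one>" if "x \<in> carrier W" for x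
    using that mult(1) c by (simp add: kern_step kern_right left_op_def right_op_def)
  have "kern a (s \<otimes> g \<otimes> h) \<one> = kern a (g \<otimes> (h \<otimes> s)) \<one>"
    using gen[of "g \<otimes> h"] mult c by (simp add: m_assoc)
  also have "\<dots> = kern a (h \<otimes> s \<otimes> g) \<one>" using mult c by simp
  finally show ?case using mult c by (simp add: m_assoc)
qed simp

lemma kern_gram:
  assumes F: "finite F" "F \<subseteq> carrier W" and U: "finite U" "\<And>g. g \<in> F \<Longrightarrow> supp (kern a g) \<subseteq> U"
  shows "(\<Sum>g\<in>F. \<Sum>h\<in>F. cnj (c g) * c h * kern a (inv g \<otimes> h) \<one>)
     = of_real (\<Sum>w\<in>U. (cmod (\<Sum>g\<in>F. c g * kern a g w))\<^sup>2)"
proof -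
  have "(\<Sum>g\<in>F. \<Sum>h\<in>F. cnj (c g) * c h * kern a (inv g \<otimes> h) \<one>)
      = (\<Sum>g\<in>F. \<Sum>h\<in>F. \<Sum>w\<in>U. (cnj (c g) * kern a g w) * (c h * kern a h w))"
  proof (intro sum.cong HOL.refl)
    fix g h assume "g \<in> F" "h \<in> F"
    then have "kern a (inv g \<otimes> h) \<one> = (\<Sum>w\<in>U. kern a g w * kern a h w)"
      using kern_inv_mult[of g h] pair_superset[OF U(1) U(2)] F by auto
    then show "cnj (c g) * c h * kern a (inv g \<otimes> h) \<one>
        = (\<Sum>w\<in>U. (cnj (c g) * kern a g w) * (c h * kern a h w))"
      by (simp add: sum_distrib_left mult_ac)
  qed
  also have "\<dots> = (\<Sum>g\<in>F. \<Sum>w\<in>U. \<Sum>h\<in>F. (cnj (c g) * kern a g w) * (c h * kern a h w))"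
    by (rule sum.cong[OF HOL.refl sum.swap])
  also have "\<dots> = (\<Sum>w\<in>U. \<Sum>g\<in>F. \<Sum>h\<in>F. (cnj (c g) * kern a g w) * (c h * kern a h w))"
    by (rule sum.swap)
  also have "\<dots> = (\<Sum>w\<in>U. cnj (\<Sum>g\<in>F. c g * kern a g w) * (\<Sum>g\<in>F. c g * kern a g w))"
  proof (rule sum.cong[OF HOL.refl])
    fix w
    have "cnj (\<Sum>g\<in>F. c g * kern a g w) = (\<Sum>g\<in>F. cnj (c g) * kern a g w)"
      unfolding cnj_sum complex_cnj_mult using F cnj_kern by (intro sum.cong HOL.refl) auto
    then show "(\<Sum>g\<in>F. \<Sum>h\<in>F. (cnj (c g) * kern a g w) * (c h * kern a h w))
        = cnj (\<Sum>g\<in>F. c g * kern a g w) * (\<Sum>g\<in>F. c g * kern a g w)"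
      by (simp only: sum_product)
  qed
  also have "\<dots> = of_real (\<Sum>w\<in>U. (cmod (\<Sum>g\<in>F. c g * kern a g w))\<^sup>2)"
    unfolding of_real_sum
    by (rule sum.cong[OF HOL.refl]) (simp only: complex_norm_square mult.commute)
  finally show ?thesis .
qed

lemma deformed_trace_character: "deformed_trace a \<in> characters W"
proof -
  have "positive_definite W (deformed_trace a)"
    unfolding positive_definite_def
  proof (intro allI impI)
    fix F and c :: "'a \<Rightarrow> complex" assume F: "finite F \<and> F \<subseteq> carrier W"
    let ?U = "\<Union>g\<in>F. supp (kern a g)"
    have U: "finite ?U" using F finsupp_kern by (auto simp: finsupp_def)
    have "(\<Sum>g\<in>F. \<Sum>h\<in>F. cnj (c g) * c h * deformed_trace a (inv g \<otimes> h))
       = (\<Sum>g\<in>F. \<Sum>h\<in>F. cnj (c g) * c h * kern a (inv g \<otimes> h) \<one>)"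
      using F by (intro sum.cong HOL.refl) (auto simp: deformed_trace_def)
    also have "\<dots> = of_real (\<Sum>w\<in>?U. (cmod (\<Sum>g\<in>F. c g * kern a g w))\<^sup>2)"
      by (rule kern_gram) (use F U in auto)
    finally show "(\<Sum>g\<in>F. \<Sum>h\<in>F. cnj (c g) * c h * deformed_trace a (inv g \<otimes> h)) \<in> \<real>\<^sub>\<ge>\<^sub>0"
      by (simp add: sum_nonneg del: of_real_sum)
  qed
  moreover have "deformed_trace a (h \<otimes> g \<otimes> inv h) = deformed_trace a g"
    if "g \<in> carrier W" "h \<in> carrier W" for g h
    using kern_trace[of "h \<otimes> g" "inv h"] that by (simp add: deformed_trace_def flip: m_assoc)
  moreover have "deformed_trace a \<one> = 1" by (simp add: deformed_trace_def kern_one delta_def)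
  ultimately show ?thesis by (simp add: characters_def deformed_trace_def)
qed

lemma deformed_trace_gen:
  assumes "s \<in> S"
  shows "deformed_trace a s = of_real (a s)"
proof -
  have "s \<noteq> \<one>" using N_gen[of s s] N_one assms S_carrier by auto
  then have "left_op a s (delta \<one>) \<one> = of_real (a s)"
    using assms S_carrier[OF assms] by (simp add: left_op_def delta_def diag_coef_def)
  then show ?thesis
    using kern_step[of s \<one>] assms S_carrier[OF assms] by (simp add: deformed_trace_def kern_one)
qed

end

lemma deformed_trace_zero: "deformed_trace (\<lambda>_. 0) = regular_trace W"
proof -
  have a: "admissible (\<lambda>_. 0)" by (simp add: admissible_def)
  have "kern (\<lambda>_. 0) g w = delta g w" if "g \<in> carrier W" "w \<in> carrier W" for g w
    using that
  proof (induction arbitrary: w rule: W_induct)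
    case (mult s g)
    have "s \<otimes> w = g \<longleftrightarrow> w = s \<otimes> g" using mult by auto
    then show ?case using mult S_carrier[of s] by (simp add: kern_step[OF a] left_op_def diag_coef_def off_coef_def delta_def)
  qed (simp add: kern_one[OF a])
  then show ?thesis by (auto simp: deformed_trace_def regular_trace_def delta_def restrict_def)
qed

section \<open>Factoriality of small deformations\<close>

lemma character_nonneg:
  assumes "\<tau> \<in> characters W" "finite F" "F \<subseteq> carrier W"
  shows "(\<Sum>g\<in>F. \<Sum>h\<in>F. cnj (c g) * c h * \<tau> (inv g \<otimes> h)) \<in> \<real>\<^sub>\<ge>\<^sub>0"
  using assms by (simp add: characters_def positive_definite_def)

text \<open>Positivity on the two-element set \<open>{\<one>, g}\<close> with the coefficients \<open>1\<close> and \<open>\<i>\<close>.\<close>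

lemma character_hermitian:
  assumes \<tau>: "\<tau> \<in> characters W" and g: "g \<in> carrier W"
  shows "\<tau> (inv g) = cnj (\<tau> g)"
proof (cases "g = \<one>")
  case True
  then show ?thesis using \<tau> by (simp add: characters_def)
next
  case False
  have pd: "1 + z * \<tau> g + (cnj z * \<tau> (inv g) + cnj z * z) \<in> \<real>\<^sub>\<ge>\<^sub>0" for z
  proof -
    have "(\<Sum>x\<in>{\<one>, g}. \<Sum>y\<in>{\<one>, g}. cnj (if x = \<one> then 1 else z) * (if y = \<one> then 1 else z) * \<tau> (inv x \<otimes> y)) \<in> \<real>\<^sub>\<ge>\<^sub>0"
      by (rule character_nonneg[OF \<tau>]) (use g in auto)
    then show ?thesis using False g \<tau> by (simp add: characters_def)
  qed
  have "Im (\<tau> g) + Im (\<tau> (inv g)) = 0"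
    using pd[of 1] by (simp add: complex_nonneg_Reals_iff)
  moreover have "Re (\<tau> g) - Re (\<tau> (inv g)) = 0"
    using pd[of \<i>] by (simp add: complex_nonneg_Reals_iff)
  ultimately show ?thesis by (simp add: complex_eq_iff)
qed

text \<open>The Cauchy-Schwarz inequality for \<open>c\<close> and the point mass \<open>e\<close> at \<open>\<one>\<close>: the form is nonnegative on
  \<open>c - P e\<close>, the component of \<open>c\<close> orthogonal to \<open>e\<close>.\<close>

lemma character_cauchy_schwarz:
  assumes \<tau>: "\<tau> \<in> characters W" and c: "finsupp c"
  shows "(cmod (pair c \<tau>))\<^sup>2 \<le> Re (\<Sum>g\<in>supp c. \<Sum>h\<in>supp c. cnj (c g) * c h * \<tau> (inv g \<otimes> h))"
proof -
  define F where "F = insert \<one> (supp c)"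
  define P where "P = pair c \<tau>"
  define e :: "'a \<Rightarrow> complex" where "e g = (if g = \<one> then 1 else 0)" for g
  define B where "B x y = (\<Sum>g\<in>F. \<Sum>h\<in>F. cnj (x g) * y h * \<tau> (inv g \<otimes> h))" for x y
  have F: "finite F" "F \<subseteq> carrier W" "supp c \<subseteq> F" "\<one> \<in> F" using c by (auto simp: F_def finsupp_def)
  have t1: "\<tau> \<one> = 1" using \<tau> by (simp add: characters_def)
  have e_sum: "(\<Sum>h\<in>F. e h * f h) = f \<one>" "(\<Sum>h\<in>F. f h * e h) = f \<one>" for f
    using F by (simp_all add: e_def if_distrib[of "\<lambda>x. x * _"] if_distrib[of "\<lambda>x. _ * x"] cong: if_cong)
  have Bcc: "B c c = (\<Sum>g\<in>supp c. \<Sum>h\<in>supp c. cnj (c g) * c h * \<tau> (inv g \<otimes> h))"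
  proof -
    have "B c c = (\<Sum>g\<in>F. \<Sum>h\<in>supp c. cnj (c g) * c h * \<tau> (inv g \<otimes> h))"
      unfolding B_def by (intro sum.cong[OF HOL.refl] sum.mono_neutral_right F) (auto simp: supp_def)
    also have "\<dots> = (\<Sum>g\<in>supp c. \<Sum>h\<in>supp c. cnj (c g) * c h * \<tau> (inv g \<otimes> h))"
      by (intro sum.mono_neutral_right F) (auto simp: supp_def)
    finally show ?thesis .
  qed
  have P: "P = (\<Sum>h\<in>F. c h * \<tau> h)" unfolding P_def by (rule pair_superset[OF F(1,3)])
  have Bec: "B e c = P"
  proof -
    have "B e c = (\<Sum>g\<in>F. e g * (\<Sum>h\<in>F. c h * \<tau> (inv g \<otimes> h)))"
      unfolding B_def by (intro sum.cong[OF HOL.refl]) (simp add: e_def sum_distrib_left mult_ac)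
    also have "\<dots> = (\<Sum>h\<in>F. c h * \<tau> (inv \<one> \<otimes> h))" by (rule e_sum(1))
    also have "\<dots> = P" unfolding P using F by (intro sum.cong[OF HOL.refl]) auto
    finally show ?thesis .
  qed
  have Bce: "B c e = cnj P"
  proof -
    have "B c e = (\<Sum>g\<in>F. cnj (c g) * \<tau> (inv g \<otimes> \<one>))"
      unfolding B_def
    proof (rule sum.cong[OF HOL.refl])
      fix g
      have "(\<Sum>h\<in>F. cnj (c g) * e h * \<tau> (inv g \<otimes> h)) = (\<Sum>h\<in>F. e h * (cnj (c g) * \<tau> (inv g \<otimes> h)))"
        by (simp add: mult_ac)
      also have "\<dots> = cnj (c g) * \<tau> (inv g \<otimes> \<one>)" by (rule e_sum(1))
      finally show "(\<Sum>h\<in>F. cnj (c g) * e h * \<tau> (inv g \<otimes> h)) = cnj (c g) * \<tau> (inv g \<otimes> \<one>)" .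
    qed
    also have "\<dots> = (\<Sum>g\<in>F. cnj (c g * \<tau> g))"
      using F character_hermitian[OF \<tau>] by (intro sum.cong[OF HOL.refl]) auto
    finally show ?thesis by (simp add: P)
  qed
  have Bee: "B e e = 1"
  proof -
    have "B e e = (\<Sum>g\<in>F. e g * (\<Sum>h\<in>F. e h * \<tau> (inv g \<otimes> h)))"
      unfolding B_def by (intro sum.cong[OF HOL.refl]) (simp add: e_def sum_distrib_left mult_ac)
    then show ?thesis by (simp add: e_sum t1)
  qed
  have "B (\<lambda>g. c g - P * e g) (\<lambda>g. c g - P * e g) = B c c - P * B c e - cnj P * B e c + cnj P * P * B e e"
    unfolding B_def
    by (simp add: algebra_simps sum.distrib sum_subtractf sum_distrib_left)
  also have "\<dots> = B c c - of_real ((cmod P)\<^sup>2)"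
    unfolding Bec Bce Bee complex_norm_square by (simp add: algebra_simps)
  finally have "B (\<lambda>g. c g - P * e g) (\<lambda>g. c g - P * e g) = B c c - of_real ((cmod P)\<^sup>2)" .
  moreover have "B (\<lambda>g. c g - P * e g) (\<lambda>g. c g - P * e g) \<in> \<real>\<^sub>\<ge>\<^sub>0"
    unfolding B_def by (rule character_nonneg[OF \<tau> F(1,2)])
  ultimately have "Re (B c c) - (cmod P)\<^sup>2 \<ge> 0" by (simp add: complex_nonneg_Reals_iff)
  then show ?thesis by (simp add: Bcc P_def)
qed

lemma character_positive:
  assumes "\<tau> \<in> characters W" "finsupp c"
  shows "0 \<le> Re (\<Sum>g\<in>supp c. \<Sum>h\<in>supp c. cnj (c g) * c h * \<tau> (inv g \<otimes> h))"
  using character_cauchy_schwarz[OF assms] by (meson order_trans zero_le_power2)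

definition comb :: "('a \<Rightarrow> real) \<Rightarrow> ('a \<Rightarrow> complex) \<Rightarrow> 'a \<Rightarrow> complex" where
  "comb a c w = (\<Sum>g\<in>supp c. c g * kern a g w)"

lemma comb_pair: "comb a c w = pair c (\<lambda>g. kern a g w)"
  by (simp add: comb_def pair_def)

context
  fixes a :: "'a \<Rightarrow> real"
  assumes a: "admissible a"
begin

lemma pair_comb: "finsupp c \<Longrightarrow> pair (comb a c) \<xi> = pair c (\<lambda>g. pair (kern a g) \<xi>)"
  unfolding comb_def[abs_def] finsupp_def[of c] pair_def[of c]
  by (intro pair_combination) (auto intro: finsupp_kern[OF a])

lemma comb_delta: "comb a (delta g) = kern a g"
  by (simp add: comb_pair fun_eq_iff)

lemma comb_combination:
  assumes "finite I" "\<And>i. i \<in> I \<Longrightarrow> finsupp (c i)"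
  shows "comb a (\<lambda>g. \<Sum>i\<in>I. z i * c i g) = (\<lambda>w. \<Sum>i\<in>I. z i * comb a (c i) w)"
  unfolding comb_pair[abs_def] using assms by (simp add: pair_combination)

definition spanned :: "('a \<Rightarrow> complex) \<Rightarrow> bool" where
  "spanned f \<longleftrightarrow> (\<exists>c. finsupp c \<and> comb a c = f)"

lemma spanned_combination:
  assumes I: "finite I" and f: "\<And>i. i \<in> I \<Longrightarrow> spanned (f i)"
  shows "spanned (\<lambda>w. \<Sum>i\<in>I. z i * f i w)"
proof -
  obtain c where c: "\<And>i. i \<in> I \<Longrightarrow> finsupp (c i) \<and> comb a (c i) = f i"
    using f unfolding spanned_def by metis
  then have "comb a (\<lambda>g. \<Sum>i\<in>I. z i * c i g) = (\<lambda>w. \<Sum>i\<in>I. z i * f i w)"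
    using I by (simp add: comb_combination)
  moreover have "finsupp (\<lambda>g. \<Sum>i\<in>I. z i * c i g)"
    using I c by (intro finsupp_combination) auto
  ultimately show ?thesis unfolding spanned_def by blast
qed

lemma spanned_kern: "g \<in> carrier W \<Longrightarrow> spanned (kern a g)"
  unfolding spanned_def using comb_delta finsupp_delta by blast

lemma spanned_left_op:
  assumes f: "spanned f" and s: "s \<in> S"
  shows "spanned (left_op a s f)"
proof -
  obtain c where c: "finsupp c" "comb a c = f" using f by (auto simp: spanned_def)
  have "left_op a s f w = (\<Sum>g\<in>supp c. c g * kern a (s \<otimes> g) w)" for w
  proof -
    have "(\<Sum>g\<in>supp c. c g * kern a (s \<otimes> g) w) = (\<Sum>g\<in>supp c. c g * left_op a s (kern a g) w)"
      using c s by (intro sum.cong[OF HOL.refl]) (auto simp: finsupp_def kern_step[OF a])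
    also have "\<dots> = left_op a s (comb a c) w"
      by (simp add: left_op_def comb_def sum_distrib_left sum.distrib algebra_simps)
    finally show ?thesis by (simp add: c)
  qed
  then have "left_op a s f = (\<lambda>w. \<Sum>g\<in>supp c. c g * kern a (s \<otimes> g) w)" by auto
  moreover have "spanned \<dots>"
    using c s S_carrier by (intro spanned_combination spanned_kern) (auto simp: finsupp_def)
  ultimately show ?thesis by simp
qed

text \<open>The orbit of the point mass at \<open>\<one>\<close> spans all finitely supported functions: as \<open>b \<noteq> 0\<close>,
  the point mass at \<open>s v\<close> can be solved for in the image of the point mass at \<open>v\<close> under \<open>s\<close>.\<close>

lemma spanned_delta: "v \<in> carrier W \<Longrightarrow> spanned (delta v)"
proof (induction rule: W_induct)
  case one
  then show ?case using spanned_kern[of \<one>] by (simp add: kern_one[OF a])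
next
  case (mult s v)
  have c: "s \<in> carrier W" using mult S_carrier by simp
  define z where "z i = (if i then 1 / off_coef a s else - diag_coef a s v / off_coef a s)" for i
  define f where "f i = (if i then left_op a s (delta v) else delta v)" for i
  have "spanned (\<lambda>w. \<Sum>i\<in>UNIV. z i * f i w)"
    using mult by (intro spanned_combination) (auto simp: f_def spanned_left_op)
  moreover have "(\<Sum>i\<in>UNIV. z i * f i w) = delta (s \<otimes> v) w" for w
  proof -
    have "(s \<otimes> w = v) = (w = s \<otimes> v)" if "w \<in> carrier W" using that mult by auto
    then have "left_op a s (delta v) w = diag_coef a s v * delta v w + off_coef a s * delta (s \<otimes> v) w"
      using mult c by (auto simp: left_op_def delta_def)
    then show ?thesis
      using off_coef_nonzero[OF a mult(1)] by (simp add: UNIV_bool z_def f_def field_simps)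
  qed
  ultimately show ?case by simp
qed

end

lemma convex_part_bounded:
  assumes a: "admissible a"
    and \<phi>: "\<phi> \<in> characters W" and \<psi>: "\<psi> \<in> characters W" and u: "0 < u" "u < 1"
    and mix: "\<And>g. g \<in> carrier W \<Longrightarrow> deformed_trace a g = (1 - u) *\<^sub>R \<phi> g + u *\<^sub>R \<psi> g"
    and c: "finsupp c" and V: "finite V" "supp (comb a c) \<subseteq> V"
  shows "u * (cmod (pair c \<psi>))\<^sup>2 \<le> (\<Sum>w\<in>V. (cmod (comb a c w))\<^sup>2)"
proof -
  let ?Q = "\<lambda>\<tau>. \<Sum>g\<in>supp c. \<Sum>h\<in>supp c. cnj (c g) * c h * \<tau> (inv g \<otimes> h)"
  have F: "finite (supp c)" "supp c \<subseteq> carrier W" using c by (auto simp: finsupp_def)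
  let ?U = "V \<union> (\<Union>g\<in>supp c. supp (kern a g))"
  have U: "finite ?U" using V F finsupp_kern[OF a] by (auto simp: finsupp_def)
  have "?Q (\<lambda>g. kern a g \<one>) = ?Q (\<lambda>g. (1 - u) *\<^sub>R \<phi> g + u *\<^sub>R \<psi> g)"
    using F mix by (intro sum.cong[OF HOL.refl]) (auto simp: deformed_trace_def subset_iff)
  also have "\<dots> = (1 - u) *\<^sub>R ?Q \<phi> + u *\<^sub>R ?Q \<psi>"
    by (simp add: sum.distrib scaleR_sum_right distrib_left)
  finally have "Re (?Q (\<lambda>g. kern a g \<one>)) = (1 - u) * Re (?Q \<phi>) + u * Re (?Q \<psi>)" by simp
  moreover have "?Q (\<lambda>g. kern a g \<one>) = of_real (\<Sum>w\<in>?U. (cmod (comb a c w))\<^sup>2)"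
    unfolding comb_def by (rule kern_gram[OF a F U]) auto
  moreover have "(\<Sum>w\<in>?U. (cmod (comb a c w))\<^sup>2) = (\<Sum>w\<in>V. (cmod (comb a c w))\<^sup>2)"
    using U V by (intro sum.mono_neutral_right) (auto simp: supp_def)
  moreover have "0 \<le> (1 - u) * Re (?Q \<phi>)"
    using character_positive[OF \<phi> c] u by (intro mult_nonneg_nonneg) auto
  moreover have "u * (cmod (pair c \<psi>))\<^sup>2 \<le> u * Re (?Q \<psi>)"
    using character_cauchy_schwarz[OF \<psi> c] u by (intro mult_left_mono) auto
  ultimately show ?thesis by simp
qed

text \<open>By \<open>convex_part_bounded\<close> the value of \<open>\<psi>\<close> on a combination \<open>c\<close> of group elements depends only on the
  vector \<open>comb a c\<close>. So \<open>\<xi> w\<close> can be defined as the value on any combination that represents the point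
  mass at \<open>w\<close>; testing the same bound on the combination with coefficients \<open>cnj (\<xi> w)\<close> yields square
  summability.\<close>

lemma convex_part_vector:
  assumes a: "admissible a"
    and \<phi>: "\<phi> \<in> characters W" and \<psi>: "\<psi> \<in> characters W" and u: "0 < u" "u < 1"
    and mix: "\<And>g. g \<in> carrier W \<Longrightarrow> deformed_trace a g = (1 - u) *\<^sub>R \<phi> g + u *\<^sub>R \<psi> g"
  obtains \<xi> where "\<And>g. g \<in> carrier W \<Longrightarrow> \<psi> g = pair (kern a g) \<xi>"
    "(\<lambda>w. (cmod (\<xi> w))\<^sup>2) summable_on carrier W"
    "\<And>s w. s \<in> S \<Longrightarrow> w \<in> carrier W \<Longrightarrow> left_op a s \<xi> w = right_op a s \<xi> w"
proof -
  note bound = convex_part_bounded[OF a \<phi> \<psi> u mix]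
  obtain C where C: "\<And>w. w \<in> carrier W \<Longrightarrow> finsupp (C w) \<and> comb a (C w) = delta w"
    using spanned_delta[OF a] unfolding spanned_def[OF a] by metis
  define \<xi> where "\<xi> w = pair (C w) \<psi>" for w
  have unique: "pair c \<psi> = pair c' \<psi>" if c: "finsupp c" "finsupp c'" "comb a c = comb a c'" for c c'
  proof -
    define z :: "bool \<Rightarrow> complex" where "z i = (if i then 1 else -1)" for i
    define f where "f i = (if i then c else c')" for i
    let ?d = "\<lambda>g. \<Sum>i\<in>UNIV. z i * f i g"
    have f: "finsupp (f i)" for i using c by (simp add: f_def)
    have "comb a ?d = (\<lambda>w. \<Sum>i\<in>UNIV. z i * comb a (f i) w)"
      using f by (intro comb_combination[OF a]) auto
    also have "\<dots> = (\<lambda>w. 0)" using c by (simp add: UNIV_bool z_def f_def)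
    finally have 0: "comb a ?d = (\<lambda>w. 0)" .
    have "u * (cmod (pair ?d \<psi>))\<^sup>2 \<le> (\<Sum>w\<in>{}. (cmod (comb a ?d w))\<^sup>2)"
      using f by (intro bound finsupp_combination) (auto simp: 0 supp_def)
    then have "pair ?d \<psi> = 0" using u by (simp add: mult_le_0_iff)
    moreover have "pair ?d \<psi> = (\<Sum>i\<in>UNIV. z i * pair (f i) \<psi>)"
      using f by (intro pair_combination) auto
    ultimately show ?thesis by (simp add: UNIV_bool z_def f_def)
  qed
  have expand: "pair (\<lambda>g. \<Sum>w\<in>F. z w * C w g) \<psi> = (\<Sum>w\<in>F. z w * \<xi> w)"
    "finsupp (\<lambda>g. \<Sum>w\<in>F. z w * C w g)"
    "comb a (\<lambda>g. \<Sum>w\<in>F. z w * C w g) = (\<lambda>v. \<Sum>w\<in>F. z w * delta w v)"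
    if F: "finite F" "F \<subseteq> carrier W" for F z
  proof -
    have c: "finsupp (C w)" "comb a (C w) = delta w" if "w \<in> F" for w using C F that by auto
    show "pair (\<lambda>g. \<Sum>w\<in>F. z w * C w g) \<psi> = (\<Sum>w\<in>F. z w * \<xi> w)"
      unfolding \<xi>_def by (rule pair_combination[OF F(1) c(1)])
    show "finsupp (\<lambda>g. \<Sum>w\<in>F. z w * C w g)"
      by (rule finsupp_combination[OF F(1) c(1)])
    show "comb a (\<lambda>g. \<Sum>w\<in>F. z w * C w g) = (\<lambda>v. \<Sum>w\<in>F. z w * delta w v)"
    proof -
      have "comb a (\<lambda>g. \<Sum>w\<in>F. z w * C w g) = (\<lambda>v. \<Sum>w\<in>F. z w * comb a (C w) v)"
        by (rule comb_combination[OF a F(1) c(1)])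
      also have "\<dots> = (\<lambda>v. \<Sum>w\<in>F. z w * delta w v)"
        by (intro ext sum.cong[OF HOL.refl]) (simp add: c(2))
      finally show ?thesis .
    qed
  qed
  have delta_sum: "(\<Sum>w\<in>F. z w * delta w v) = (if v \<in> F then z v else 0)" if "finite F" for F z v
  proof -
    have "(\<Sum>w\<in>F. z w * delta w v) = (\<Sum>w\<in>F. if v = w then z w else 0)"
      by (intro sum.cong[OF HOL.refl]) (auto simp: delta_def)
    then show ?thesis using that by simp
  qed
  have \<psi>_eq: "\<psi> g = pair (kern a g) \<xi>" if g: "g \<in> carrier W" for g
  proof -
    have F: "finite (supp (kern a g))" "supp (kern a g) \<subseteq> carrier W"
      using finsupp_kern[OF a g] by (auto simp: finsupp_def)
    let ?c = "\<lambda>h. \<Sum>w\<in>supp (kern a g). kern a g w * C w h"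
    have "comb a ?c = kern a g"
      unfolding expand(3)[OF F] delta_sum[OF F(1)] by (auto simp: supp_def)
    then have "pair (delta g) \<psi> = pair ?c \<psi>"
      using g by (intro unique expand(2)[OF F]) (simp_all add: comb_delta[OF a])
    then show ?thesis unfolding expand(1)[OF F] by (simp add: pair_def[of "kern a g"])
  qed
  have l2: "(\<Sum>w\<in>F. (cmod (\<xi> w))\<^sup>2) \<le> 1 / u" if F: "finite F" "F \<subseteq> carrier W" for F
  proof -
    let ?c = "\<lambda>h. \<Sum>w\<in>F. cnj (\<xi> w) * C w h"
    define n where "n = (\<Sum>w\<in>F. (cmod (\<xi> w))\<^sup>2)"
    have n: "n \<ge> 0" unfolding n_def by (simp add: sum_nonneg)
    have comb: "comb a ?c = (\<lambda>v. if v \<in> F then cnj (\<xi> v) else 0)"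
      unfolding expand(3)[OF F] delta_sum[OF F(1)] by simp
    have "pair ?c \<psi> = (\<Sum>w\<in>F. \<xi> w * cnj (\<xi> w))"
      unfolding expand(1)[OF F] by (simp add: mult.commute)
    also have "\<dots> = of_real n"
      unfolding n_def of_real_sum by (simp only: complex_norm_square)
    finally have "(cmod (pair ?c \<psi>))\<^sup>2 = n\<^sup>2" by simp
    moreover have "u * (cmod (pair ?c \<psi>))\<^sup>2 \<le> (\<Sum>w\<in>F. (cmod (comb a ?c w))\<^sup>2)"
      by (rule bound[OF _ expand(2)[OF F] F(1)]) (auto simp: comb supp_def)
    moreover have "(\<Sum>w\<in>F. (cmod (comb a ?c w))\<^sup>2) = n"
      unfolding n_def comb by (intro sum.cong[OF HOL.refl]) simp
    ultimately have "u * n * n \<le> 1 * n" by (simp add: power2_eq_square)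
    then have "n = 0 \<or> u * n \<le> 1" using n mult_right_le_imp_le[of "u * n" n 1] by fastforce
    then show ?thesis using u by (auto simp: n_def[symmetric] field_simps)
  qed
  have summable: "(\<lambda>w. (cmod (\<xi> w))\<^sup>2) summable_on carrier W"
    by (rule nonneg_bdd_above_summable_on) (use l2 in \<open>auto intro!: bdd_aboveI[where M = "1 / u"]\<close>)
  have central: "left_op a s \<xi> w = right_op a s \<xi> w" if s: "s \<in> S" and w: "w \<in> carrier W" for s w
  proof -
    have c: "s \<in> carrier W" using s S_carrier by simp
    have eq: "pair (kern a g) (left_op a s \<xi>) = pair (kern a g) (right_op a s \<xi>)" if g: "g \<in> carrier W" for g
    proof -
      have "pair (kern a g) (left_op a s \<xi>) = \<psi> (s \<otimes> g)"
        using g c s by (simp add: \<psi>_eq kern_step[OF a] pair_left_op finsupp_kern[OF a])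
      moreover have "pair (kern a g) (right_op a s \<xi>) = \<psi> (g \<otimes> s)"
        using g c s by (simp add: \<psi>_eq kern_right[OF a] pair_right_op finsupp_kern[OF a])
      moreover have "\<psi> (s \<otimes> (g \<otimes> s) \<otimes> inv s) = \<psi> (g \<otimes> s)"
        using \<psi> g c unfolding characters_def by simp
      moreover have "s \<otimes> (g \<otimes> s) \<otimes> inv s = s \<otimes> g" using g c by (simp add: m_assoc)
      ultimately show ?thesis by simp
    qed
    have sub: "supp (C w) \<subseteq> carrier W" using C[OF w] by (simp add: finsupp_def)
    have "pair (C w) (\<lambda>g. pair (kern a g) (left_op a s \<xi>)) = pair (C w) (\<lambda>g. pair (kern a g) (right_op a s \<xi>))"
      unfolding pair_def[of "C w"] using sub eq by (intro sum.cong[OF HOL.refl]) auto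
    then show ?thesis
      using C[OF w] pair_comb[OF a, of "C w"] by (metis pair_delta)
  qed
  show thesis by (rule that[OF \<psi>_eq summable central])
qed

text \<open>Evaluating centrality at \<open>s w\<close> gives \<open>b (\<xi> w - \<xi> (s w s)) = \<kappa> \<xi> (s w)\<close> with \<open>\<bar>\<kappa>\<bar> \<le> 2 \<bar>a s\<bar>\<close>,
  for all \<open>w\<close>. If one of the three points is \<open>\<one>\<close>, then \<open>s w s = w\<close>, so nothing is lost by replacing the
  value at \<open>\<one>\<close> by \<open>0\<close>.\<close>

lemma central_vector_almost_invariant:
  assumes a: "admissible a" and \<epsilon>: "\<epsilon> > 0"
    and small: "\<And>s. s \<in> S \<Longrightarrow> 2 * \<bar>a s\<bar> \<le> \<epsilon> * sqrt (1 - (a s)\<^sup>2)"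
    and summable: "(\<lambda>w. (cmod (\<xi> w))\<^sup>2) summable_on carrier W"
    and central: "\<And>s w. s \<in> S \<Longrightarrow> w \<in> carrier W \<Longrightarrow> left_op a s \<xi> w = right_op a s \<xi> w"
  shows "almost_invariant \<epsilon> (\<lambda>w. if w = \<one> then 0 else (cmod (\<xi> w))\<^sup>2)"
proof -
  let ?f = "\<lambda>w. if w = \<one> then 0 else (cmod (\<xi> w))\<^sup>2"
  have "(\<lambda>w. (cmod (\<xi> w))\<^sup>2) summable_on (carrier W - {\<one>})"
    by (rule summable_on_subset[OF summable]) auto
  then have "?f summable_on carrier W"
    by (rule summable_on_cong_neutral[THEN iffD1, rotated -1]) auto
  moreover have "?f w \<le> ?f (s \<otimes> w \<otimes> s) + \<epsilon> * (?f (s \<otimes> w) + ?f (s \<otimes> w \<otimes> s) + ?f w)"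
    if s: "s \<in> S" and w: "w \<in> carrier W" for s w
  proof -
    have c: "s \<in> carrier W" using s S_carrier by simp
    define b where "b = sqrt (1 - (a s)\<^sup>2)"
    have b: "b > 0"
      using a s abs_square_less_1[of "a s"] by (auto simp: admissible_def b_def)
    have off_coef: "off_coef a s = of_real b" by (simp add: off_coef_def b_def)
    define x y z where "x = cmod (\<xi> w)" and "y = cmod (\<xi> (s \<otimes> w \<otimes> s))" and "z = cmod (\<xi> (s \<otimes> w))"
    have "left_op a s \<xi> (s \<otimes> w) = right_op a s \<xi> (s \<otimes> w)" using central s w c by simp
    then have "diag_coef a s (s \<otimes> w) * \<xi> (s \<otimes> w) + off_coef a s * \<xi> w
        = diag_coef a s (inv (s \<otimes> w)) * \<xi> (s \<otimes> w) + off_coef a s * \<xi> (s \<otimes> w \<otimes> s)"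
      using w c s by (simp add: left_op_def right_op_def)
    then have "of_real b * (\<xi> w - \<xi> (s \<otimes> w \<otimes> s)) = (diag_coef a s (inv (s \<otimes> w)) - diag_coef a s (s \<otimes> w)) * \<xi> (s \<otimes> w)"
      by (simp add: algebra_simps off_coef)
    then have "cmod (of_real b * (\<xi> w - \<xi> (s \<otimes> w \<otimes> s))) = cmod (diag_coef a s (inv (s \<otimes> w)) - diag_coef a s (s \<otimes> w)) * z"
      by (simp add: norm_mult z_def)
    also have "\<dots> \<le> (2 * \<bar>a s\<bar>) * z"
    proof (rule mult_right_mono)
      have "cmod (diag_coef a s (inv (s \<otimes> w)) - diag_coef a s (s \<otimes> w)) \<le> cmod (diag_coef a s (inv (s \<otimes> w))) + cmod (diag_coef a s (s \<otimes> w))"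
        by (rule norm_triangle_ineq4)
      also have "\<dots> = 2 * \<bar>a s\<bar>" by (simp add: diag_coef_def)
      finally show "cmod (diag_coef a s (inv (s \<otimes> w)) - diag_coef a s (s \<otimes> w)) \<le> 2 * \<bar>a s\<bar>" .
    qed (simp add: z_def)
    also have "\<dots> \<le> (\<epsilon> * b) * z" using small[OF s] by (intro mult_right_mono) (auto simp: b_def z_def)
    finally have "b * cmod (\<xi> w - \<xi> (s \<otimes> w \<otimes> s)) \<le> b * (\<epsilon> * z)" using b by (simp add: norm_mult mult_ac)
    then have "cmod (\<xi> w - \<xi> (s \<otimes> w \<otimes> s)) \<le> \<epsilon> * z" using b by simp
    then have diff: "x - y \<le> \<epsilon> * z"
      using norm_triangle_ineq2[of "\<xi> w" "\<xi> (s \<otimes> w \<otimes> s)"] by (simp add: x_def y_def)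
    have nn: "x \<ge> 0" "y \<ge> 0" "z \<ge> 0" by (simp_all add: x_def y_def z_def)
    have "x\<^sup>2 - y\<^sup>2 = (x - y) * (x + y)" by (simp add: power2_eq_square algebra_simps)
    also have "\<dots> \<le> (\<epsilon> * z) * (x + y)" using diff nn by (intro mult_right_mono) auto
    also have "\<dots> \<le> \<epsilon> * (z\<^sup>2 + y\<^sup>2 + x\<^sup>2)"
    proof -
      have "0 \<le> (z - x)\<^sup>2 + (z - y)\<^sup>2 + x\<^sup>2 + y\<^sup>2" by simp
      then have "z * (x + y) \<le> z\<^sup>2 + y\<^sup>2 + x\<^sup>2" by (simp add: power2_eq_square algebra_simps)
      then show ?thesis using \<epsilon> mult_left_mono[of "z * (x + y)" _ \<epsilon>] by (simp add: mult.assoc)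
    qed
    finally have main: "x\<^sup>2 \<le> y\<^sup>2 + \<epsilon> * (z\<^sup>2 + y\<^sup>2 + x\<^sup>2)" by simp
    consider "w = \<one>" | "s \<otimes> w = \<one>" | "w \<noteq> \<one>" "s \<otimes> w \<noteq> \<one>" by blast
    then show ?thesis
    proof cases
      case 1
      then show ?thesis using c s S_square \<epsilon> by simp
    next
      case 2
      have "w = s \<otimes> (s \<otimes> w)" using s w by simp
      then have "w = s" using 2 c by simp
      then have "s \<otimes> w \<otimes> s = w" using 2 c by simp
      moreover have "0 \<le> ?f v" for v by simp
      ultimately show ?thesis using \<epsilon> by (simp add: add_nonneg_nonneg)
    next
      case 3
      have "s \<otimes> w \<otimes> s \<noteq> \<one>"
      proof
        assume "s \<otimes> w \<otimes> s = \<one>"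
        then have "w = s \<otimes> \<one> \<otimes> s" using S_conj_conj[OF s w] by simp
        then show False using 3 s c S_square by simp
      qed
      then show ?thesis using 3 main by (simp add: x_def y_def z_def)
    qed
  qed
  ultimately show ?thesis by (auto simp: almost_invariant_def)
qed

lemma deformed_trace_extremal:
  assumes gap: "\<And>f w. almost_invariant \<epsilon> f \<Longrightarrow> f \<one> = 0 \<Longrightarrow> w \<in> carrier W \<Longrightarrow> f w = 0"
    and a: "admissible a" and \<epsilon>: "\<epsilon> > 0"
    and small: "\<And>s. s \<in> S \<Longrightarrow> 2 * \<bar>a s\<bar> \<le> \<epsilon> * sqrt (1 - (a s)\<^sup>2)"
  shows "deformed_trace a \<in> extremal_characters W"
proof -
  have "\<phi> = \<psi>"
    if \<phi>: "\<phi> \<in> characters W" and \<psi>: "\<psi> \<in> characters W" and u: "0 < u" "u < 1"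
      and mix: "\<forall>g\<in>carrier W. deformed_trace a g = (1 - u) *\<^sub>R \<phi> g + u *\<^sub>R \<psi> g" for \<phi> \<psi> u
  proof -
    obtain \<xi> where \<xi>: "\<And>g. g \<in> carrier W \<Longrightarrow> \<psi> g = pair (kern a g) \<xi>"
      and sm: "(\<lambda>w. (cmod (\<xi> w))\<^sup>2) summable_on carrier W"
      and ce: "\<And>s w. s \<in> S \<Longrightarrow> w \<in> carrier W \<Longrightarrow> left_op a s \<xi> w = right_op a s \<xi> w"
      using convex_part_vector[OF a \<phi> \<psi> u] mix by blast
    have zero: "\<xi> w = 0" if "w \<in> carrier W" "w \<noteq> \<one>" for w
      using gap[OF central_vector_almost_invariant[OF a \<epsilon> small sm ce], of w] that by simp
    have \<psi>1: "\<psi> g = kern a g \<one> * \<xi> \<one>" if g: "g \<in> carrier W" for g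
    proof -
      have F: "finite (supp (kern a g))" "supp (kern a g) \<subseteq> carrier W"
        using finsupp_kern[OF a g] by (auto simp: finsupp_def)
      have "\<psi> g = (\<Sum>w\<in>insert \<one> (supp (kern a g)). kern a g w * \<xi> w)"
        unfolding \<xi>[OF g] using F by (intro pair_superset) auto
      also have "\<dots> = (\<Sum>w\<in>{\<one>}. kern a g w * \<xi> w)"
        using F zero by (intro sum.mono_neutral_right) auto
      finally show ?thesis by simp
    qed
    have "\<xi> \<one> = 1"
      using \<psi>1[of \<one>] \<psi> by (simp add: kern_one[OF a] delta_def characters_def)
    then have \<psi>t: "\<psi> g = deformed_trace a g" if "g \<in> carrier W" for g
      using \<psi>1 that by (simp add: deformed_trace_def)
    have "\<phi> g = \<psi> g" if g: "g \<in> carrier W" for g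
    proof -
      have "\<psi> g = (1 - u) *\<^sub>R \<phi> g + u *\<^sub>R \<psi> g" using mix \<psi>t[OF g] g by simp
      then have "(1 - u) *\<^sub>R (\<phi> g - \<psi> g) = 0" by (auto simp: algebra_simps)
      then show ?thesis using u by simp
    qed
    then show ?thesis
      using \<phi> \<psi> by (intro extensionalityI[of \<phi> "carrier W" \<psi>]) (auto simp: characters_def)
  qed
  then show ?thesis
    using deformed_trace_character[OF a] unfolding extremal_characters_def by blast
qed

end

section \<open>A ball of extremal characters\<close>

text \<open>Puts the ball into the form for which continuity is \<^const>\<open>continuous_on\<close>.\<close>

lemma euclidean_ball_top_of_set:
  "euclidean_ball n = top_of_set {x. (\<forall>k\<ge>n. x k = 0) \<and> (\<Sum>k<n. x k ^ 2) \<le> 1}"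
  by (simp add: euclidean_ball_def Euclidean_space_def euclidean_product_topology subtopology_subtopology
      Collect_conj_eq)

context racg
begin

lemma continuous_deformed_trace:
  fixes p :: "'p::topological_space \<Rightarrow> 'a \<Rightarrow> real"
  assumes adm: "\<And>x. x \<in> B \<Longrightarrow> admissible (p x)"
    and cont: "\<And>s. s \<in> S \<Longrightarrow> continuous_on B (\<lambda>x. p x s)"
    and g: "g \<in> carrier W"
  shows "continuous_on B (\<lambda>x. deformed_trace (p x) g)"
proof -
  have "continuous_on B (\<lambda>x. kern (p x) g w)" for w
    using g
  proof (induction arbitrary: w rule: W_induct)
    case one
    show ?case by (rule continuous_on_eq[OF continuous_on_const]) (simp add: kern_one[OF adm])
  next
    case (mult s g)
    have eq: "kern (p x) (s \<otimes> g) w = left_op (p x) s (kern (p x) g) w" if "x \<in> B" for x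
      using kern_step[OF adm[OF that]] mult by simp
    have "continuous_on B (\<lambda>x. diag_coef (p x) s w)"
      unfolding diag_coef_def using cont[OF mult(1)] by (cases "s \<in> N w"; simp; intro continuous_intros)
    moreover have "continuous_on B (\<lambda>x. off_coef (p x) s)"
      unfolding off_coef_def using cont[OF mult(1)] by (intro continuous_intros)
    ultimately have "continuous_on B (\<lambda>x. left_op (p x) s (kern (p x) g) w)"
      unfolding left_op_def using mult.IH by (cases "w \<in> carrier W"; simp; intro continuous_intros)
    then show ?case by (rule continuous_on_eq) (simp add: eq)
  qed
  then show ?thesis using g by (simp add: deformed_trace_def)
qed

text \<open>The parameters are the coordinates of a point of the ball, scaled by \<open>\<delta>\<close>. Reading off the values
  of a character at the generators is a continuous inverse, because \<open>\<chi>\<^sub>a(s) = a s\<close>.\<close>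

lemma extremal_ball:
  assumes gap: "\<And>f w. almost_invariant \<epsilon> f \<Longrightarrow> f \<one> = 0 \<Longrightarrow> w \<in> carrier W \<Longrightarrow> f w = 0"
    and \<epsilon>: "\<epsilon> > 0" and fin: "finite S"
  shows "\<exists>E h. E \<subseteq> extremal_characters W \<and>
           euclidean_subspace_via (character_topology W) (card S) E h \<and>
           regular_trace W \<in> h ` euclidean_ball_interior (card S)"
proof -
  define n where "n = card S"
  obtain i where i: "bij_betw i S {..<n}"
    using ex_bij_betw_finite_nat[OF fin] by (auto simp: n_def atLeast0LessThan)
  define j where "j = inv_into S i"
  have j: "j k \<in> S" "i (j k) = k" if "k < n" for k
    using i that unfolding j_def bij_betw_def by (auto intro: inv_into_into f_inv_into_f)
  have i_less: "i s < n" if "s \<in> S" for s using i that by (auto simp: bij_betw_def)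
  define \<delta> where "\<delta> = min (1/2) (\<epsilon> / 4)"
  have \<delta>: "\<delta> > 0" "\<delta> \<le> 1/2" "\<delta> \<le> \<epsilon> / 4" using \<epsilon> by (auto simp: \<delta>_def)
  define B where "B = {x :: nat \<Rightarrow> real. (\<forall>k\<ge>n. x k = 0) \<and> (\<Sum>k<n. x k ^ 2) \<le> 1}"
  have ball: "euclidean_ball n = top_of_set B" by (simp add: B_def euclidean_ball_top_of_set)
  define p where "p x s = \<delta> * x (i s)" for x :: "nat \<Rightarrow> real" and s
  define h where "h x = deformed_trace (p x)" for x
  define k where "k \<tau> = (\<lambda>l. if l < n then Re (\<tau> (j l)) / \<delta> else 0)" for \<tau> :: "'a \<Rightarrow> complex"
  have p_le: "\<bar>p x s\<bar> \<le> \<delta>" if x: "x \<in> B" and s: "s \<in> S" for x s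
  proof -
    have "x (i s) ^ 2 \<le> (\<Sum>k<n. x k ^ 2)"
      using i_less[OF s] by (intro member_le_sum) auto
    then have "x (i s) ^ 2 \<le> 1" using x by (simp add: B_def)
    then have "\<bar>x (i s)\<bar> \<le> 1" by (simp add: abs_square_le_1)
    then show ?thesis using \<delta> mult_left_mono[of "\<bar>x (i s)\<bar>" 1 \<delta>] by (simp add: p_def abs_mult)
  qed
  have adm: "admissible (p x)" if "x \<in> B" for x
    using p_le[OF that] \<delta> by (force simp: admissible_def)
  have small: "2 * \<bar>p x s\<bar> \<le> \<epsilon> * sqrt (1 - (p x s)\<^sup>2)" if x: "x \<in> B" and s: "s \<in> S" for x s
  proof -
    have "(p x s)\<^sup>2 \<le> (1/2)\<^sup>2"
      using p_le[OF x s] \<delta> power_mono[of "\<bar>p x s\<bar>" "1/2" 2] by simp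
    then have "1/2 \<le> sqrt (1 - (p x s)\<^sup>2)" by (intro real_le_rsqrt) (simp add: power2_eq_square)
    then have "\<epsilon> * (1/2) \<le> \<epsilon> * sqrt (1 - (p x s)\<^sup>2)" using \<epsilon> by (intro mult_left_mono) auto
    moreover have "2 * \<bar>p x s\<bar> \<le> \<epsilon> * (1/2)" using p_le[OF x s] \<delta> by simp
    ultimately show ?thesis by (rule order_trans[rotated])
  qed
  have extremal: "h ` B \<subseteq> extremal_characters W"
  proof safe
    fix x assume x: "x \<in> B"
    show "h x \<in> extremal_characters W"
      unfolding h_def
    proof (rule deformed_trace_extremal[of \<epsilon> "p x"])
      show "f w = 0" if "almost_invariant \<epsilon> f" "f \<one> = 0" "w \<in> carrier W" for f w
        using gap that by blast
    qed (use adm \<epsilon> small x in auto)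
  qed
  then have chars: "h ` B \<subseteq> characters W" by (auto simp: extremal_characters_def)
  have kh: "k (h x) = x" if x: "x \<in> B" for x
  proof
    fix l
    show "k (h x) l = x l"
    proof (cases "l < n")
      case True
      then have "h x (j l) = of_real (p x (j l))"
        unfolding h_def using deformed_trace_gen[OF adm[OF x]] j by simp
      then show ?thesis using True j[OF True] \<delta> by (simp add: k_def p_def)
    qed (use x in \<open>simp add: k_def B_def\<close>)
  qed
  let ?P = "product_topology (\<lambda>_. euclidean :: complex topology) (carrier W)"
  let ?Y = "subtopology (character_topology W) (h ` B)"
  have Y: "?Y = subtopology ?P (h ` B)"
    using chars by (simp add: character_topology_def subtopology_subtopology Int_absorb1)
  have topY: "topspace ?Y = h ` B"
    using chars by (auto simp: Y characters_def PiE_def)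
  have "continuous_map (top_of_set B) ?P h"
    unfolding continuous_map_componentwise
  proof (intro conjI ballI)
    show "h ` topspace (top_of_set B) \<subseteq> extensional (carrier W)"
      using chars by (auto simp: characters_def)
    fix g assume g: "g \<in> carrier W"
    have "continuous_on B (\<lambda>x. p x s)" for s
      unfolding p_def
      by (intro continuous_intros continuous_on_subset[OF continuous_on_product_coordinates]) auto
    then show "continuous_map (top_of_set B) euclidean (\<lambda>x. h x g)"
      unfolding h_def continuous_map_iff_continuous
      by (intro continuous_deformed_trace adm g)
  qed
  then have cont_h: "continuous_map (euclidean_ball n) ?Y h"
    by (simp add: Y ball continuous_map_in_subtopology)
  have "continuous_map ?Y (Euclidean_space n) k"
    unfolding k_def continuous_map_componentwise_Euclidean_space
  proof (intro allI impI)
    fix l assume l: "l < n"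
    have "continuous_map ?P euclidean (\<lambda>\<tau>. \<tau> (j l))"
      using continuous_map_product_projection[of "j l" "carrier W" "\<lambda>_. euclidean :: complex topology"]
        j[OF l] S_carrier by simp
    then have "continuous_map ?P euclideanreal ((\<lambda>z. Re z / \<delta>) \<circ> (\<lambda>\<tau>. \<tau> (j l)))"
      by (rule continuous_map_compose) (use \<delta> in \<open>auto intro!: continuous_intros\<close>)
    then show "continuous_map ?Y euclideanreal (\<lambda>\<tau>. Re (\<tau> (j l)) / \<delta>)"
      unfolding Y by (simp add: o_def continuous_map_from_subtopology)
  qed
  moreover have "k ` topspace ?Y \<subseteq> B" unfolding topY using kh by auto
  ultimately have cont_k: "continuous_map ?Y (euclidean_ball n) k"
    unfolding euclidean_ball_def continuous_map_in_subtopology by (auto simp: B_def)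
  have "homeomorphic_maps (euclidean_ball n) ?Y h k"
    unfolding homeomorphic_maps_def using cont_h cont_k kh topY by (auto simp: ball)
  then have "homeomorphic_map (euclidean_ball n) ?Y h"
    by (rule homeomorphic_maps_imp_map)
  moreover have "h ` B \<subseteq> topspace (character_topology W)"
    using chars by (auto simp: character_topology_def characters_def PiE_def)
  ultimately have via: "euclidean_subspace_via (character_topology W) n (h ` B) h"
    by (simp add: euclidean_subspace_via_def)
  have "h (\<lambda>_. 0) = regular_trace W"
    using deformed_trace_zero by (simp add: h_def p_def[abs_def])
  moreover have "(\<lambda>_. 0) \<in> euclidean_ball_interior n"
    by (simp add: euclidean_ball_interior_def topspace_Euclidean_space)
  ultimately have "regular_trace W \<in> h ` euclidean_ball_interior n" by (metis imageI)
  then show ?thesis using via extremal unfolding n_def by blast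
qed

end

theorem corollaryD:
  fixes W :: "('a, 'b) monoid_scheme" and S :: "'a set" and m :: "'a \<Rightarrow> 'a \<Rightarrow> enat"
  assumes "right_angled_coxeter_system W S m"
    and "coxeter_irreducible W S"
    and "finite S" and "card S \<ge> 3"
  shows "\<exists>E h. E \<subseteq> extremal_characters W \<and>
           euclidean_subspace_via (character_topology W) (card S) E h \<and>
           regular_trace W \<in> h ` euclidean_ball_interior (card S)"
proof -
  have "group W"
    using assms(1) by (simp add: right_angled_coxeter_system_def presented_by_def)
  then interpret racg W S m
    using assms(1) by (simp add: racg_def racg_axioms_def)
  obtain \<epsilon> where "\<epsilon> > 0"
    "\<And>f w. almost_invariant \<epsilon> f \<Longrightarrow> f \<one>\<^bsub>W\<^esub> = 0 \<Longrightarrow> w \<in> carrier W \<Longrightarrow> f w = 0"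
    using spectral_gap[OF assms(2-4)] by blast
  then show ?thesis using extremal_ball[of \<epsilon>] assms(3) by blast
qed

end
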